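(* Let $\mathcal{A}_{fin}$ be the $*$-subalgebra of $C(S^2_{qc})$ generated by $A$ and $B$. Then $$\left(\mathcal{A}_{fin},\ \mathcal{H}=\mathcal{H}_+\oplus\mathcal{H}_-,\ D=\begin{pmatrix}0&N\\N&0\end{pmatrix},\ \gamma=\begin{pmatrix}1&0\\0&-1\end{pmatrix}\right)$$ is an even spectral triple, where $\mathcal{A}_{fin}$ acts on $\mathcal{H}$ through $\pi=\pi_+\oplus\pi_-$.
   Context: Let $q$ be real with $|q|<1$ and let $c>0$. $C(S^2_{qc})$ (the Podleś quantum sphere) is the universal $C^*$-algebra generated by $A,B$ with relations $A^*=A$, $B^*B=A-A^2+cI$, $BA=q^2AB$, $BB^*=q^2A-q^4A^2+cI$. Let $\mathcal{H}_+=\mathcal{H}_-=\ell^2(\mathbb{N})$ with $\mathbb{N}=\{0,1,2,\dots\}$ and canonical orthonormal basis $(e_n)_{n\ge0}$. Put $\lambda_\pm=\frac12\pm\left(c+\frac14\right)^{1/2}$ and $c_\pm(n)=\lambda_\pm q^{2n}-(\lambda_\pm q^{2n})^2+c$ (note $c_\pm(0)=0$). The representations $\pi_\pm$ of $C(S^2_{qc})$ on $\mathcal{H}_\pm$ are given by $\pi_\pm(A)e_n=\lambda_\pm q^{2n}e_n$, $\pi_\pm(B)e_n=c_\pm(n)^{1/2}e_{n-1}$ (with $\pi_\pm(B)e_0=0$); $\pi_+\oplus\pi_-$ is faithful. $N$ denotes the self-adjoint operator $e_n\mapsto ne_n$ on $\ell^2(\mathbb{N})$. An even spectral triple $(\mathcal{B},\mathcal{H},D,\gamma)$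 consists of a $*$-algebra $\mathcal{B}$ represented by bounded operators on a Hilbert space $\mathcal{H}$, a self-adjoint operator $D$ with compact resolvent such that $[D,b]$ is densely defined and extends to a bounded operator for all $b\in\mathcal{B}$, and a self-adjoint unitary $\gamma$ commuting with $\mathcal{B}$ and anticommuting with $D$. *)

theory Defs
  imports "HOL-Analysis.Analysis" "HOL-Library.Function_Algebras"
begin

section \<open>Complex *-algebras and complex Hilbert spaces\<close>

class scaleC =
  fixes scaleC :: "complex \<Rightarrow> 'a \<Rightarrow> 'a"  (infixr "*\<^sub>C" 75)

class complex_module = ab_group_add + scaleC +
  assumes scaleC_add_right: "a *\<^sub>C (x + y) = a *\<^sub>C x + a *\<^sub>C y"
    and scaleC_add_left: "(a + b) *\<^sub>C x = a *\<^sub>C x + b *\<^sub>C x"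
    and scaleC_scaleC: "a *\<^sub>C b *\<^sub>C x = (a * b) *\<^sub>C x"
    and scaleC_one: "1 *\<^sub>C x = x"

class complex_star_algebra = ring + complex_module +
  fixes star :: "'a \<Rightarrow> 'a"
  assumes scaleC_mult_left: "(a *\<^sub>C x) * y = a *\<^sub>C (x * y)"
    and scaleC_mult_right: "x * (a *\<^sub>C y) = a *\<^sub>C (x * y)"
    and star_star: "star (star x) = x"
    and star_add: "star (x + y) = star x + star y"
    and star_scaleC: "star (a *\<^sub>C x) = cnj a *\<^sub>C star x"
    and star_mult: "star (x * y) = star y * star x"

definition star_subalgebra :: "'a::complex_star_algebra set \<Rightarrow> bool" where
  "star_subalgebra S \<longleftrightarrow>
     0 \<in> S \<and>
     (\<forall>x\<in>S. \<forall>y\<in>S. x + y \<in> S \<and> x * y \<in> S) \<and>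
     (\<forall>a. \<forall>x\<in>S. a *\<^sub>C x \<in> S) \<and>
     (\<forall>x\<in>S. star x \<in> S)"

definition star_generated :: "'a::complex_star_algebra set \<Rightarrow> 'a set" where
  "star_generated X = \<Inter>{S. star_subalgebra S \<and> X \<subseteq> S}"

definition star_hom_on ::
    "'a::complex_star_algebra set \<Rightarrow> ('a \<Rightarrow> 'b::complex_star_algebra) \<Rightarrow> bool" where
  "star_hom_on S \<pi> \<longleftrightarrow>
     (\<forall>x\<in>S. \<forall>y\<in>S. \<pi> (x + y) = \<pi> x + \<pi> y \<and> \<pi> (x * y) = \<pi> x * \<pi> y) \<and>
     (\<forall>a. \<forall>x\<in>S. \<pi> (a *\<^sub>C x) = a *\<^sub>C \<pi> x) \<and>
     (\<forall>x\<in>S. \<pi> (star x) = star (\<pi> x))"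

text \<open>The inner product \<^term>\<open>cinner\<close> is linear in its second argument.  The real
  inner product of the library class is its real part, so that norm, topology and completeness
  are those of the library.\<close>

class complex_hilbert_space = real_inner + complete_space + complex_module +
  fixes cinner :: "'a \<Rightarrow> 'a \<Rightarrow> complex"
  assumes scaleC_of_real: "complex_of_real r *\<^sub>C x = r *\<^sub>R x"
    and cinner_commute: "cinner x y = cnj (cinner y x)"
    and cinner_add_right: "cinner x (y + z) = cinner x y + cinner x z"
    and cinner_scaleC_right: "cinner x (a *\<^sub>C y) = a * cinner x y"
    and inner_eq_Re_cinner: "inner x y = Re (cinner x y)"

instance complex_hilbert_space \<subseteq> banach ..

context complex_module
begin

lemma scaleC_zero_left: "0 *\<^sub>C x = 0"
  using scaleC_add_left[of 0 0 x] by simp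

lemma scaleC_zero_right: "a *\<^sub>C 0 = 0"
  using scaleC_add_right[of a 0 0] by simp

lemma scaleC_minus_left: "(- a) *\<^sub>C x = - (a *\<^sub>C x)"
  using scaleC_add_left[of a "- a" x] by (simp add: scaleC_zero_left eq_neg_iff_add_eq_0 add.commute)

lemma scaleC_minus_right: "a *\<^sub>C (- x) = - (a *\<^sub>C x)"
  using scaleC_add_right[of a x "- x"] by (simp add: scaleC_zero_right eq_neg_iff_add_eq_0 add.commute)

end

lemma cinner_scaleC_left:
  "cinner (a *\<^sub>C x) y = cnj a * cinner (x::'a::complex_hilbert_space) y"
  by (metis cinner_commute cinner_scaleC_right complex_cnj_mult)

lemma cinner_add_left:
  "cinner (x + y) z = cinner (x::'a::complex_hilbert_space) z + cinner y z"
  by (metis cinner_commute cinner_add_right complex_cnj_add)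

lemma Im_cinner: "Im (cinner x y) = inner (\<i> *\<^sub>C x) (y::'a::complex_hilbert_space)"
  by (simp add: inner_eq_Re_cinner cinner_scaleC_left)

lemma cinner_eqI:
  fixes x y x' y' :: "'a::complex_hilbert_space"
  assumes "inner x y = inner x' y'" "inner (\<i> *\<^sub>C x) y = inner (\<i> *\<^sub>C x') y'"
  shows "cinner x y = cinner x' y'"
  using assms by (simp add: complex_eq_iff Im_cinner inner_eq_Re_cinner)

lemma cinner_self: "cinner x x = complex_of_real ((norm (x::'a::complex_hilbert_space))\<^sup>2)"
proof -
  have "Im (cinner x x) = 0"
    by (metis cinner_commute complex_cnj_cancel_iff Reals_cnj_iff complex_is_Real_iff)
  then show ?thesis
    by (simp add: complex_eq_iff inner_eq_Re_cinner[symmetric] power2_norm_eq_inner)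
qed

lemma cinner_ext:
  fixes x y :: "'a::complex_hilbert_space"
  assumes "\<And>z. cinner z x = cinner z y"
  shows "x = y"
  by (metis assms inner_eq_Re_cinner vector_eq_rdot inner_commute)

lemma norm_scaleC: "norm (a *\<^sub>C (x::'a::complex_hilbert_space)) = cmod a * norm x"
proof -
  have "complex_of_real ((norm (a *\<^sub>C x))\<^sup>2) = complex_of_real ((cmod a * norm x)\<^sup>2)"
    unfolding cinner_self[symmetric] cinner_scaleC_left cinner_scaleC_right
    by (simp add: cinner_self power_mult_distrib of_real_mult of_real_power mult.assoc[symmetric])
      (simp add: complex_norm_square[symmetric] mult.commute)
  then have "(norm (a *\<^sub>C x))\<^sup>2 = (cmod a * norm x)\<^sup>2"
    using of_real_eq_iff by blast
  then show ?thesis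
    by (simp add: power2_eq_iff_nonneg)
qed

instantiation prod :: (complex_hilbert_space, complex_hilbert_space) complex_hilbert_space
begin

definition scaleC_prod :: "complex \<Rightarrow> 'a \<times> 'b \<Rightarrow> 'a \<times> 'b" where
  "a *\<^sub>C x = (a *\<^sub>C fst x, a *\<^sub>C snd x)"

definition cinner_prod :: "'a \<times> 'b \<Rightarrow> 'a \<times> 'b \<Rightarrow> complex" where
  "cinner x y = cinner (fst x) (fst y) + cinner (snd x) (snd y)"

instance
proof
  fix a b :: complex and r :: real and x y z :: "'a \<times> 'b"
  show "a *\<^sub>C (x + y) = a *\<^sub>C x + a *\<^sub>C y" "(a + b) *\<^sub>C x = a *\<^sub>C x + b *\<^sub>C x"
    "a *\<^sub>C b *\<^sub>C x = (a * b) *\<^sub>C x" "1 *\<^sub>C x = x"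
    by (simp_all add: scaleC_prod_def scaleC_add_left scaleC_add_right scaleC_scaleC scaleC_one)
  show "complex_of_real r *\<^sub>C x = r *\<^sub>R x"
    by (simp add: scaleC_prod_def scaleC_of_real scaleR_prod_def)
  show "cinner x y = cnj (cinner y x)"
    unfolding cinner_prod_def by (metis cinner_commute complex_cnj_add)
  show "cinner x (y + z) = cinner x y + cinner x z" "cinner x (a *\<^sub>C y) = a * cinner x y"
    "inner x y = Re (cinner x y)"
    by (simp_all add: scaleC_prod_def cinner_prod_def cinner_add_right cinner_scaleC_right
        inner_eq_Re_cinner inner_prod_def algebra_simps)
qed

end

section \<open>Bounded operators\<close>

typedef (overloaded) 'a bop =
    "{f :: 'a::complex_hilbert_space \<Rightarrow> 'a. bounded_linear f \<and> (\<forall>a x. f (a *\<^sub>C x) = a *\<^sub>C f x)}"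
  morphisms app Abs_bop
  by (rule exI[of _ "\<lambda>x. 0"]) (simp add: scaleC_zero_right)

setup_lifting type_definition_bop

lemma app_bounded_linear: "bounded_linear (app T)"
  using app[of T] by simp

lemma app_scaleC: "app T (a *\<^sub>C x) = a *\<^sub>C app T x"
  using app[of T] by simp

lemma app_add: "app T (x + y) = app T x + app T y"
  by (rule linear_add) (simp add: app_bounded_linear bounded_linear.linear)

lemma bop_eqI: "(\<And>x. app S x = app T x) \<Longrightarrow> S = T"
  by (simp add: app_inject[symmetric] fun_eq_iff)

lemma riesz_real:
  fixes \<phi> :: "'a::{real_inner,complete_space} \<Rightarrow> real"
  assumes "bounded_linear \<phi>"
  shows "\<exists>z. \<forall>x. \<phi> x = inner z x"
proof -
  interpret \<phi>: bounded_linear \<phi> by fact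
  define J where "J x = (norm x)\<^sup>2 / 2 - \<phi> x" for x
  obtain K where K: "\<And>x. norm (\<phi> x) \<le> norm x * K" using \<phi>.bounded by blast
  have low: "- K\<^sup>2 / 2 \<le> J x" for x
  proof -
    have "\<phi> x \<le> norm x * K" using K[of x] by simp
    moreover have "0 \<le> (norm x - K)\<^sup>2" by simp
    ultimately show ?thesis by (simp add: J_def power2_eq_square algebra_simps)
  qed
  define m where "m = (INF x. J x)"
  have bdd: "bdd_below (range J)" using low by (meson bdd_belowI2)
  have mle: "m \<le> J x" for x unfolding m_def by (rule cINF_lower[OF bdd]) simp
  have "\<exists>x. J x < m + 1 / real (Suc n)" for n
    using cINF_less_iff[OF _ bdd, of "m + 1 / real (Suc n)"] by (simp add: m_def)
  then obtain X where X: "\<And>n. J (X n) < m + 1 / real (Suc n)" by metis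
  have par: "(norm (x - y))\<^sup>2 / 8 \<le> (J x + J y) / 2 - m" for x y
  proof -
    have "J ((1/2) *\<^sub>R (x + y)) = (J x + J y) / 2 - (norm (x - y))\<^sup>2 / 8"
      unfolding J_def \<phi>.scaleR \<phi>.add
      by (simp add: power2_norm_eq_inner inner_simps inner_commute power_mult_distrib
          norm_scaleR power_divide field_simps)
    then show ?thesis using mle[of "(1/2) *\<^sub>R (x + y)"] by linarith
  qed
  have "Cauchy X"
  proof (rule metric_CauchyI)
    fix e :: real assume e: "0 < e"
    obtain M where M: "1 / real (Suc M) < e\<^sup>2 / 8"
      using reals_Archimedean[of "e\<^sup>2 / 8"] e by (auto simp: inverse_eq_divide)
    show "\<exists>M. \<forall>i\<ge>M. \<forall>j\<ge>M. dist (X i) (X j) < e"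
    proof (intro exI allI impI)
      fix i j assume ij: "M \<le> i" "M \<le> j"
      have "1 / real (Suc i) \<le> 1 / real (Suc M)" "1 / real (Suc j) \<le> 1 / real (Suc M)"
        using ij by (auto simp: frac_le)
      then have "(norm (X i - X j))\<^sup>2 < e\<^sup>2"
        using par[of "X i" "X j"] X[of i] X[of j] M by argo
      then show "dist (X i) (X j) < e"
        using e by (simp add: dist_norm power2_less_imp_less)
    qed
  qed
  then obtain z where z: "X \<longlonglongrightarrow> z" using Cauchy_convergent convergent_def by blast
  have "(\<lambda>n. J (X n)) \<longlonglongrightarrow> J z"
    unfolding J_def by (intro tendsto_intros z \<phi>.tendsto) simp
  moreover have "(\<lambda>n. m + 1 / real (Suc n)) \<longlonglongrightarrow> m + 0"
    by (intro tendsto_add tendsto_const) (use LIMSEQ_inverse_real_of_nat in \<open>simp add: inverse_eq_divide\<close>)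
  ultimately have Jz: "J z \<le> m"
    using X by (intro LIMSEQ_le[of "\<lambda>n. J (X n)" "J z" "\<lambda>n. m + 1 / real (Suc n)" m]) (auto intro: less_imp_le)
  have "\<phi> x = inner z x" for x
  proof -
    have q: "0 \<le> t * (inner z x - \<phi> x) + t\<^sup>2 * ((norm x)\<^sup>2 / 2)" for t
    proof -
      have "J (z + t *\<^sub>R x) = J z + t * (inner z x - \<phi> x) + t\<^sup>2 * ((norm x)\<^sup>2 / 2)"
        unfolding J_def \<phi>.scaleR \<phi>.add power2_norm_eq_inner
        by (simp add: inner_simps inner_commute power2_eq_square field_simps)
      then show ?thesis using mle[of "z + t *\<^sub>R x"] Jz by linarith
    qed
    define d where "d = inner z x - \<phi> x"
    define s where "s = (norm x)\<^sup>2 / 2 + 1"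
    have s: "s > 0" "(norm x)\<^sup>2 / 2 = s - 1" by (auto simp: s_def add_nonneg_pos)
    have "0 \<le> (- d / s) * d + (- d / s)\<^sup>2 * (s - 1)" using q[of "- d / s"] s by (simp add: d_def)
    also have "\<dots> = - (d / s)\<^sup>2" using s by (simp add: field_simps power2_eq_square)
    finally have "d = 0" using s by simp
    then show ?thesis by (simp add: d_def)
  qed
  then show ?thesis by blast
qed

lemma adjoint_exists:
  fixes T :: "'a::complex_hilbert_space bop"
  shows "\<exists>S. \<forall>x y. cinner (app T x) y = cinner x (app S y)"
proof -
  interpret T: bounded_linear "app T" by (rule app_bounded_linear)
  have "\<exists>z. \<forall>x. inner (app T x) y = inner z x" for y
    by (rule riesz_real) (intro bounded_linear_compose[OF bounded_linear_inner_left] app_bounded_linear)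
  then obtain g where g: "\<And>x y. inner (app T x) y = inner x (g y)"
    by (metis inner_commute)
  have gc: "cinner (app T x) y = cinner x (g y)" for x y
    by (rule cinner_eqI) (simp_all add: g app_scaleC[symmetric])
  obtain K where K: "\<And>x. norm (app T x) \<le> norm x * K" "K \<ge> 0" using T.nonneg_bounded by blast
  have add: "g (x + y) = g x + g y" for x y
    by (rule cinner_ext) (simp add: cinner_add_right gc[symmetric])
  have scC: "g (a *\<^sub>C x) = a *\<^sub>C g x" for a x
    by (rule cinner_ext) (simp add: cinner_scaleC_right gc[symmetric])
  have "norm (g y) \<le> norm y * K" for y
  proof (cases "g y = 0")
    case False
    have "(norm (g y))\<^sup>2 = inner (app T (g y)) y" by (simp add: g power2_norm_eq_inner)
    also have "\<dots> \<le> norm (app T (g y)) * norm y" by (rule norm_cauchy_schwarz)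
    also have "\<dots> \<le> (norm (g y) * K) * norm y" by (intro mult_right_mono K) simp
    finally have "norm (g y) * norm (g y) \<le> norm (g y) * (norm y * K)"
      by (simp add: power2_eq_square algebra_simps)
    then show ?thesis using False by (simp add: mult_le_cancel_left_pos)
  qed (simp add: K)
  then have "bounded_linear g"
    by (intro bounded_linear_intro[where K = K] add) (simp_all add: scC scaleC_of_real[symmetric])
  then have "app (Abs_bop g) = g" by (simp add: Abs_bop_inverse scC)
  then show ?thesis using gc by metis
qed

lemma adjoint_unique:
  fixes T :: "'a::complex_hilbert_space bop"
  assumes "\<forall>x y. cinner (app T x) y = cinner x (app S y)" "\<forall>x y. cinner (app T x) y = cinner x (app S' y)"
  shows "S = S'"
  using assms by (intro bop_eqI cinner_ext) metis

instantiation bop :: (complex_hilbert_space) "{complex_star_algebra, monoid_mult}"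
begin

lift_definition zero_bop :: "'a bop" is "\<lambda>x. 0" by (simp add: scaleC_zero_right)

lift_definition one_bop :: "'a bop" is "\<lambda>x. x" by (simp add: bounded_linear_ident)

lift_definition plus_bop :: "'a bop \<Rightarrow> 'a bop \<Rightarrow> 'a bop" is "\<lambda>S T x. S x + T x"
  by (auto simp: scaleC_add_right intro: bounded_linear_add)

lift_definition uminus_bop :: "'a bop \<Rightarrow> 'a bop" is "\<lambda>S x. - S x"
  by (auto simp: scaleC_minus_right intro: bounded_linear_minus)

lift_definition minus_bop :: "'a bop \<Rightarrow> 'a bop \<Rightarrow> 'a bop" is "\<lambda>S T x. S x - T x"
  by (auto simp: scaleC_add_right scaleC_minus_right diff_conv_add_uminus simp del: add_uminus_conv_diff
      intro: bounded_linear_add bounded_linear_minus)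

lift_definition times_bop :: "'a bop \<Rightarrow> 'a bop \<Rightarrow> 'a bop" is "\<lambda>S T x. S (T x)"
  by (auto intro: bounded_linear_compose)

lift_definition scaleC_bop :: "complex \<Rightarrow> 'a bop \<Rightarrow> 'a bop" is "\<lambda>a S x. a *\<^sub>C S x"
proof -
  fix a :: complex and S :: "'a \<Rightarrow> 'a"
  assume S: "bounded_linear S \<and> (\<forall>a x. S (a *\<^sub>C x) = a *\<^sub>C S x)"
  have "bounded_linear (\<lambda>x::'a. a *\<^sub>C x)"
    by (rule bounded_linear_intro[where K = "cmod a"])
      (simp_all add: scaleC_add_right norm_scaleC mult.commute scaleC_scaleC scaleC_of_real[symmetric])
  then show "bounded_linear (\<lambda>x. a *\<^sub>C S x) \<and> (\<forall>b x. a *\<^sub>C S (b *\<^sub>C x) = b *\<^sub>C a *\<^sub>C S x)"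
    using S by (auto intro: bounded_linear_compose simp: scaleC_scaleC mult.commute)
qed

definition star_bop :: "'a bop \<Rightarrow> 'a bop" where
  "star T = (THE S. \<forall>x y. cinner (app T x) y = cinner x (app S y))"

lemma cinner_star: "cinner (app T x) y = cinner x (app (star (T::'a bop)) y)"
proof -
  have "\<exists>!S. \<forall>x y. cinner (app T x) y = cinner x (app S y)"
    using adjoint_exists[of T] adjoint_unique[of T] by blast
  from theI'[OF this] show ?thesis unfolding star_bop_def by blast
qed

lemma star_bopI: "(\<And>x y. cinner (app T x) y = cinner x (app S y)) \<Longrightarrow> star (T::'a bop) = S"
  by (rule adjoint_unique[of T]) (simp_all add: cinner_star)

lemma cinner_star': "cinner (app (star (T::'a bop)) x) y = cinner x (app T y)"
  by (metis cinner_commute cinner_star)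

instance
proof
  fix a b :: complex and x y z :: "'a bop"
  show "x + y + z = x + (y + z)" by transfer (simp add: add.assoc)
  show "x + y = y + x" by transfer (simp add: add.commute)
  show "0 + x = x" by transfer simp
  show "- x + x = 0" by transfer simp
  show "x - y = x + - y" by transfer simp
  show "x * y * z = x * (y * z)" by transfer simp
  show "1 * x = x" "x * 1 = x" by (transfer, simp)+
  show "(x + y) * z = x * z + y * z" by transfer simp
  show "x * (y + z) = x * y + x * z"
    by transfer (auto simp: fun_eq_iff linear_add bounded_linear.linear)
  show "a *\<^sub>C (x + y) = a *\<^sub>C x + a *\<^sub>C y" by transfer (simp add: scaleC_add_right)
  show "(a + b) *\<^sub>C x = a *\<^sub>C x + b *\<^sub>C x" by transfer (simp add: scaleC_add_left)
  show "a *\<^sub>C b *\<^sub>C x = (a * b) *\<^sub>C x" by transfer (simp add: scaleC_scaleC)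
  show "1 *\<^sub>C x = x" by transfer (simp add: scaleC_one)
  show "(a *\<^sub>C x) * y = a *\<^sub>C (x * y)" by transfer simp
  show "x * (a *\<^sub>C y) = a *\<^sub>C (x * y)" by transfer simp
  show "star (star x) = x" by (rule star_bopI) (rule cinner_star')
  show "star (x + y) = star x + star y"
    by (rule star_bopI) (simp add: plus_bop.rep_eq cinner_add_left cinner_add_right cinner_star)
  show "star (a *\<^sub>C x) = cnj a *\<^sub>C star x"
    by (rule star_bopI) (simp add: scaleC_bop.rep_eq cinner_scaleC_left cinner_scaleC_right cinner_star)
  show "star (x * y) = star y * star x"
    by (rule star_bopI) (simp add: times_bop.rep_eq cinner_star)
qed

end

lift_definition dsum ::
    "'a::complex_hilbert_space bop \<Rightarrow> 'b::complex_hilbert_space bop \<Rightarrow> ('a \<times> 'b) bop"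
  is "\<lambda>S T x. (S (fst x), T (snd x))"
  by (auto simp: scaleC_prod_def intro!: bounded_linear_Pair
      intro: bounded_linear_compose bounded_linear_fst bounded_linear_snd)

definition compact_bop :: "'a::complex_hilbert_space bop \<Rightarrow> bool" where
  "compact_bop T \<longleftrightarrow> compact (closure (app T ` ball 0 1))"

section \<open>Even spectral triples\<close>

text \<open>An unbounded operator is given by its domain \<open>V\<close> and a function \<open>D\<close>, of which
  only the values on \<open>V\<close> matter.\<close>

definition linear_operator ::
    "'a::complex_hilbert_space set \<Rightarrow> ('a \<Rightarrow> 'a) \<Rightarrow> bool" where
  "linear_operator V D \<longleftrightarrow>
     0 \<in> V \<and>
     (\<forall>x\<in>V. \<forall>y\<in>V. x + y \<in> V \<and> D (x + y) = D x + D y) \<and>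
     (\<forall>a. \<forall>x\<in>V. a *\<^sub>C x \<in> V \<and> D (a *\<^sub>C x) = a *\<^sub>C D x)"

definition adjoint_domain ::
    "'a::complex_hilbert_space set \<Rightarrow> ('a \<Rightarrow> 'a) \<Rightarrow> 'a set" where
  "adjoint_domain V D = {y. \<exists>z. \<forall>x\<in>V. cinner (D x) y = cinner x z}"

definition self_adjoint ::
    "'a::complex_hilbert_space set \<Rightarrow> ('a \<Rightarrow> 'a) \<Rightarrow> bool" where
  "self_adjoint V D \<longleftrightarrow>
     linear_operator V D \<and> closure V = UNIV \<and>
     adjoint_domain V D = V \<and>
     (\<forall>x\<in>V. \<forall>y\<in>V. cinner (D x) y = cinner x (D y))"

definition is_resolvent ::
    "'a::complex_hilbert_space set \<Rightarrow> ('a \<Rightarrow> 'a) \<Rightarrow> complex \<Rightarrow> 'a bop \<Rightarrow> bool" where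
  "is_resolvent V D z R \<longleftrightarrow>
     (\<forall>x. app R x \<in> V \<and> D (app R x) - z *\<^sub>C app R x = x) \<and>
     (\<forall>x\<in>V. app R (D x - z *\<^sub>C x) = x)"

definition compact_resolvent ::
    "'a::complex_hilbert_space set \<Rightarrow> ('a \<Rightarrow> 'a) \<Rightarrow> bool" where
  "compact_resolvent V D \<longleftrightarrow>
     (\<exists>z R. is_resolvent V D z R) \<and> (\<forall>z R. is_resolvent V D z R \<longrightarrow> compact_bop R)"

definition bounded_commutator ::
    "'a::complex_hilbert_space set \<Rightarrow> ('a \<Rightarrow> 'a) \<Rightarrow> 'a bop \<Rightarrow> bool" where
  "bounded_commutator V D b \<longleftrightarrow>
     closure {x\<in>V. app b x \<in> V} = UNIV \<and>
     (\<exists>T. \<forall>x\<in>V. app b x \<in> V \<longrightarrow> app T x = D (app b x) - app b (D x))"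

definition even_spectral_triple ::
    "'b::complex_star_algebra set \<Rightarrow> ('b \<Rightarrow> 'a::complex_hilbert_space bop) \<Rightarrow>
     'a set \<Rightarrow> ('a \<Rightarrow> 'a) \<Rightarrow> 'a bop \<Rightarrow> bool" where
  "even_spectral_triple \<B> \<pi> V D \<gamma> \<longleftrightarrow>
     star_subalgebra \<B> \<and> star_hom_on \<B> \<pi> \<and>
     self_adjoint V D \<and> compact_resolvent V D \<and>
     (\<forall>b\<in>\<B>. bounded_commutator V D (\<pi> b)) \<and>
     star \<gamma> = \<gamma> \<and> \<gamma> * \<gamma> = 1 \<and>
     (\<forall>b\<in>\<B>. \<gamma> * \<pi> b = \<pi> b * \<gamma>) \<and>
     (\<forall>x\<in>V. app \<gamma> x \<in> V \<and> D (app \<gamma> x) = - app \<gamma> (D x))"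

section \<open>The Hilbert space of square-summable sequences\<close>

lemma square_summable_add:
  fixes f g :: "nat \<Rightarrow> complex"
  assumes "summable (\<lambda>n. (cmod (f n))\<^sup>2)" "summable (\<lambda>n. (cmod (g n))\<^sup>2)"
  shows "summable (\<lambda>n. (cmod (f n + g n))\<^sup>2)"
proof (rule summable_comparison_test')
  show "summable (\<lambda>n. 2 * (cmod (f n))\<^sup>2 + 2 * (cmod (g n))\<^sup>2)"
    by (intro summable_add summable_mult assms)
  fix n
  have "(cmod (f n + g n))\<^sup>2 \<le> (cmod (f n) + cmod (g n))\<^sup>2"
    by (intro power_mono norm_triangle_ineq norm_ge_zero)
  also have "\<dots> \<le> 2 * (cmod (f n))\<^sup>2 + 2 * (cmod (g n))\<^sup>2"
    using zero_le_power2[of "cmod (f n) - cmod (g n)"] by (simp add: power2_eq_square algebra_simps)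
  finally show "norm ((cmod (f n + g n))\<^sup>2) \<le> 2 * (cmod (f n))\<^sup>2 + 2 * (cmod (g n))\<^sup>2" by simp
qed

lemma square_summable_bounded_mult:
  fixes f w :: "nat \<Rightarrow> complex"
  assumes "summable (\<lambda>n. (cmod (f n))\<^sup>2)" "\<And>n. cmod (w n) \<le> K"
  shows "summable (\<lambda>n. (cmod (w n * f n))\<^sup>2)"
proof (rule summable_comparison_test')
  show "summable (\<lambda>n. K\<^sup>2 * (cmod (f n))\<^sup>2)" by (intro summable_mult assms)
  show "norm ((cmod (w n * f n))\<^sup>2) \<le> K\<^sup>2 * (cmod (f n))\<^sup>2" for n
    by (simp add: norm_mult power_mult_distrib mult_right_mono power_mono assms(2))
qed

lemma square_summable_cinner:
  fixes f g :: "nat \<Rightarrow> complex"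
  assumes "summable (\<lambda>n. (cmod (f n))\<^sup>2)" "summable (\<lambda>n. (cmod (g n))\<^sup>2)"
  shows "summable (\<lambda>n. cnj (f n) * g n)"
proof (rule summable_comparison_test')
  show "summable (\<lambda>n. (cmod (f n))\<^sup>2 + (cmod (g n))\<^sup>2)" by (intro summable_add assms)
  fix n
  have "0 \<le> (cmod (f n))\<^sup>2 + (cmod (g n))\<^sup>2 - 2 * (cmod (f n) * cmod (g n))"
    using zero_le_power2[of "cmod (f n) - cmod (g n)"] by (simp add: power2_eq_square algebra_simps)
  moreover have "0 \<le> cmod (f n) * cmod (g n)" by simp
  ultimately have "cmod (f n) * cmod (g n) \<le> (cmod (f n))\<^sup>2 + (cmod (g n))\<^sup>2" by linarith
  then show "norm (cnj (f n) * g n) \<le> (cmod (f n))\<^sup>2 + (cmod (g n))\<^sup>2"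
    by (simp add: norm_mult)
qed

typedef ell2 = "{f :: nat \<Rightarrow> complex. summable (\<lambda>n. (cmod (f n))\<^sup>2)}"
  morphisms coord Abs_ell2
  by (rule exI[of _ "\<lambda>n. 0"]) simp

setup_lifting type_definition_ell2

lemma ell2_eqI: "(\<And>n. coord x n = coord y n) \<Longrightarrow> x = y"
  by (simp add: coord_inject[symmetric] fun_eq_iff)

lemma coord_square_summable: "summable (\<lambda>n. (cmod (coord x n))\<^sup>2)"
  using coord[of x] by simp

lemma coord_cinner_summable: "summable (\<lambda>n. cnj (coord x n) * coord y n)"
  by (intro square_summable_cinner coord_square_summable)

instantiation ell2 :: complex_module
begin

lift_definition zero_ell2 :: ell2 is "\<lambda>n. 0" by simp

lift_definition plus_ell2 :: "ell2 \<Rightarrow> ell2 \<Rightarrow> ell2" is "\<lambda>f g n. f n + g n"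
  by (rule square_summable_add)

lift_definition uminus_ell2 :: "ell2 \<Rightarrow> ell2" is "\<lambda>f n. - f n" by simp

lift_definition minus_ell2 :: "ell2 \<Rightarrow> ell2 \<Rightarrow> ell2" is "\<lambda>f g n. f n - g n"
  unfolding diff_conv_add_uminus by (rule square_summable_add) simp_all

lift_definition scaleC_ell2 :: "complex \<Rightarrow> ell2 \<Rightarrow> ell2" is "\<lambda>a f n. a * f n"
  by (rule square_summable_bounded_mult) auto

instance
  by standard (transfer; simp add: algebra_simps)+

end

instantiation ell2 :: real_inner
begin

definition inner_ell2 :: "ell2 \<Rightarrow> ell2 \<Rightarrow> real" where
  "inner x y = (\<Sum>n. Re (cnj (coord x n) * coord y n))"

definition norm_ell2 :: "ell2 \<Rightarrow> real" where
  "norm x = sqrt (inner x (x::ell2))"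

definition scaleR_ell2 :: "real \<Rightarrow> ell2 \<Rightarrow> ell2" where
  "r *\<^sub>R x = complex_of_real r *\<^sub>C (x::ell2)"

definition sgn_ell2 :: "ell2 \<Rightarrow> ell2" where
  "sgn x = inverse (norm x) *\<^sub>R (x::ell2)"

definition dist_ell2 :: "ell2 \<Rightarrow> ell2 \<Rightarrow> real" where
  "dist x y = norm (x - y :: ell2)"

definition uniformity_ell2 :: "(ell2 \<times> ell2) filter" where
  "uniformity = (INF e\<in>{0<..}. principal {(x::ell2, y). dist x y < e})"

definition open_ell2 :: "ell2 set \<Rightarrow> bool" where
  "open U \<longleftrightarrow> (\<forall>x\<in>U. eventually (\<lambda>(x', y::ell2). x' = x \<longrightarrow> y \<in> U) uniformity)"

lemma inner_ell2_summable: "summable (\<lambda>n. Re (cnj (coord x n) * coord y n))"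
  by (rule summable_Re[OF coord_cinner_summable])

lemma inner_ell2_self: "inner x (x::ell2) = (\<Sum>n. (cmod (coord x n))\<^sup>2)"
  unfolding inner_ell2_def cmod_power2 by (simp add: power2_eq_square)

instance
proof
  fix x y z :: ell2 and r s :: real
  show "r *\<^sub>R (x + y) = r *\<^sub>R x + r *\<^sub>R y" "(r + s) *\<^sub>R x = r *\<^sub>R x + s *\<^sub>R x"
    "r *\<^sub>R s *\<^sub>R x = (r * s) *\<^sub>R x" "1 *\<^sub>R x = x"
    by (simp_all add: scaleR_ell2_def scaleC_add_left scaleC_add_right scaleC_scaleC scaleC_one)
  show "inner x y = inner y x"
    unfolding inner_ell2_def by (simp add: mult.commute)
  show "inner (x + y) z = inner x z + inner y z"
    unfolding inner_ell2_def suminf_add[OF inner_ell2_summable inner_ell2_summable]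
    by (simp add: plus_ell2.rep_eq algebra_simps)
  show "inner (r *\<^sub>R x) y = r * inner x y"
    unfolding inner_ell2_def suminf_mult[OF inner_ell2_summable, symmetric]
    by (simp add: scaleR_ell2_def scaleC_ell2.rep_eq algebra_simps)
  show "0 \<le> inner x x"
    by (simp add: inner_ell2_self suminf_nonneg coord_square_summable)
  show "inner x x = 0 \<longleftrightarrow> x = 0"
  proof
    assume "inner x x = 0"
    then have "\<forall>n. (cmod (coord x n))\<^sup>2 = 0"
      unfolding inner_ell2_self
      by (subst (asm) suminf_eq_zero_iff) (auto simp: coord_square_summable)
    then show "x = 0" by (intro ell2_eqI) (simp add: zero_ell2.rep_eq)
  next
    assume "x = 0" then show "inner x x = 0" by (simp add: inner_ell2_self zero_ell2.rep_eq)
  qed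
qed (auto simp: norm_ell2_def sgn_ell2_def dist_ell2_def uniformity_ell2_def open_ell2_def)

end

lemma norm_ell2_power2: "(norm x)\<^sup>2 = (\<Sum>n. (cmod (coord x n))\<^sup>2)"
  by (simp add: power2_norm_eq_inner inner_ell2_self)

lemma sum_coord_le: "(\<Sum>n<N. (cmod (coord x n))\<^sup>2) \<le> (norm x)\<^sup>2"
  unfolding norm_ell2_power2 by (rule sum_le_suminf) (simp_all add: coord_square_summable)

lemma norm_coord_le: "cmod (coord x n) \<le> norm x"
proof -
  have "(cmod (coord x n))\<^sup>2 \<le> (\<Sum>n<Suc n. (cmod (coord x n))\<^sup>2)" by (simp add: sum_nonneg)
  also have "\<dots> \<le> (norm x)\<^sup>2" by (rule sum_coord_le)
  finally show ?thesis by (rule power2_le_imp_le) simp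
qed

instance ell2 :: complete_space
proof
  fix X :: "nat \<Rightarrow> ell2"
  assume X: "Cauchy X"
  have "Cauchy (\<lambda>m. coord (X m) n)" for n
  proof (rule metric_CauchyI)
    fix e :: real assume "0 < e"
    then obtain M where M: "\<And>i j. i \<ge> M \<Longrightarrow> j \<ge> M \<Longrightarrow> dist (X i) (X j) < e"
      using metric_CauchyD[OF X] by blast
    have "dist (coord (X i) n) (coord (X j) n) < e" if "i \<ge> M" "j \<ge> M" for i j
      using norm_coord_le[of "X i - X j" n] M[OF that] by (simp add: dist_norm minus_ell2.rep_eq)
    then show "\<exists>M. \<forall>i\<ge>M. \<forall>j\<ge>M. dist (coord (X i) n) (coord (X j) n) < e" by blast
  qed
  then have "\<exists>l. (\<lambda>m. coord (X m) n) \<longlonglongrightarrow> l" for n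
    using Cauchy_convergent convergent_def by blast
  then obtain f where f: "\<And>n. (\<lambda>m. coord (X m) n) \<longlonglongrightarrow> f n" by metis
  have tail: "summable (\<lambda>n. (cmod (coord (X i) n - f n))\<^sup>2) \<and>
      (\<Sum>n. (cmod (coord (X i) n - f n))\<^sup>2) \<le> e\<^sup>2"
    if e: "0 < e" and M: "\<And>j. j \<ge> M \<Longrightarrow> dist (X i) (X j) < e" for e i M
  proof -
    have part: "(\<Sum>n<N. (cmod (coord (X i) n - f n))\<^sup>2) \<le> e\<^sup>2" for N
    proof (rule LIMSEQ_le_const2)
      show "(\<lambda>j. \<Sum>n<N. (cmod (coord (X i) n - coord (X j) n))\<^sup>2)
          \<longlonglongrightarrow> (\<Sum>n<N. (cmod (coord (X i) n - f n))\<^sup>2)"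
        by (intro tendsto_intros f)
      have "(\<Sum>n<N. (cmod (coord (X i) n - coord (X j) n))\<^sup>2) \<le> e\<^sup>2" if "j \<ge> M" for j
      proof -
        have "(\<Sum>n<N. (cmod (coord (X i - X j) n))\<^sup>2) \<le> (norm (X i - X j))\<^sup>2"
          by (rule sum_coord_le)
        also have "\<dots> \<le> e\<^sup>2"
          using M[OF that] by (intro power_mono) (simp_all add: dist_norm)
        finally show ?thesis by (simp add: minus_ell2.rep_eq)
      qed
      then show "\<exists>M. \<forall>j\<ge>M. (\<Sum>n<N. (cmod (coord (X i) n - coord (X j) n))\<^sup>2) \<le> e\<^sup>2" by blast
    qed
    then have s: "summable (\<lambda>n. (cmod (coord (X i) n - f n))\<^sup>2)"
      by (intro summableI_nonneg_bounded) simp_all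
    with part show ?thesis by (auto intro: suminf_le_const)
  qed
  have fsum: "summable (\<lambda>n. (cmod (f n))\<^sup>2)"
  proof -
    obtain M where M: "\<And>i j. i \<ge> M \<Longrightarrow> j \<ge> M \<Longrightarrow> dist (X i) (X j) < 1"
      using metric_CauchyD[OF X, of 1] by auto
    have "summable (\<lambda>n. (cmod (- (coord (X M) n - f n)))\<^sup>2)"
      using tail[of 1 M M] M by (simp add: norm_minus_commute)
    from square_summable_add[OF this coord_square_summable[of "X M"]] show ?thesis by simp
  qed
  have "X \<longlonglongrightarrow> Abs_ell2 f"
  proof (rule metric_LIMSEQ_I)
    fix r :: real assume r: "0 < r"
    then obtain M where M: "\<And>i j. i \<ge> M \<Longrightarrow> j \<ge> M \<Longrightarrow> dist (X i) (X j) < r / 2"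
      using metric_CauchyD[OF X, of "r / 2"] by auto
    have "dist (X i) (Abs_ell2 f) < r" if "i \<ge> M" for i
    proof -
      have "(norm (X i - Abs_ell2 f))\<^sup>2 \<le> (r / 2)\<^sup>2"
        using tail[of "r / 2" M i] M[OF that] r
        by (simp add: norm_ell2_power2 minus_ell2.rep_eq Abs_ell2_inverse fsum)
      then have "norm (X i - Abs_ell2 f) \<le> r / 2" by (rule power2_le_imp_le) (use r in simp)
      then show ?thesis using r by (simp add: dist_norm)
    qed
    then show "\<exists>M. \<forall>i\<ge>M. dist (X i) (Abs_ell2 f) < r" by blast
  qed
  then show "convergent X" by (rule convergentI)
qed

instantiation ell2 :: complex_hilbert_space
begin

definition cinner_ell2 :: "ell2 \<Rightarrow> ell2 \<Rightarrow> complex" where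
  "cinner x y = (\<Sum>n. cnj (coord x n) * coord y n)"

instance
proof
  fix x y z :: ell2 and r :: real and a :: complex
  show "complex_of_real r *\<^sub>C x = r *\<^sub>R x" by (simp add: scaleR_ell2_def)
  have "(\<lambda>n. cnj (coord y n) * coord x n) sums cinner y x"
    unfolding cinner_ell2_def by (rule summable_sums[OF coord_cinner_summable])
  then have "(\<lambda>n. cnj (cnj (coord y n) * coord x n)) sums cnj (cinner y x)"
    by (simp only: sums_cnj)
  then show "cinner x y = cnj (cinner y x)"
    unfolding cinner_ell2_def[of x y] by (simp add: sums_iff mult.commute)
  show "cinner x (y + z) = cinner x y + cinner x z"
    unfolding cinner_ell2_def suminf_add[OF coord_cinner_summable coord_cinner_summable]
    by (simp add: plus_ell2.rep_eq distrib_left)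
  show "cinner x (a *\<^sub>C y) = a * cinner x y"
    unfolding cinner_ell2_def suminf_mult[OF coord_cinner_summable, symmetric]
    by (simp add: scaleC_ell2.rep_eq algebra_simps)
  show "inner x y = Re (cinner x y)"
    unfolding cinner_ell2_def inner_ell2_def
    by (rule Re_suminf[symmetric, OF coord_cinner_summable])
qed

end

lift_definition basis_vec :: "nat \<Rightarrow> ell2" is "\<lambda>n m. if m = n then 1 else 0"
proof -
  fix n :: nat
  have "summable (\<lambda>m. if m = n then (1::real) else 0)" by (rule summable_single)
  moreover have "(\<lambda>m. (cmod (if m = n then 1 else 0))\<^sup>2) = (\<lambda>m. if m = n then (1::real) else 0)" by auto
  ultimately show "summable (\<lambda>m. (cmod (if m = n then 1 else 0))\<^sup>2)" by simp
qed

text \<open>The operator \<open>e\<^sub>n \<mapsto> n e\<^sub>n\<close> on its maximal domain.\<close>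

definition number_dom :: "ell2 set" where
  "number_dom = {x. summable (\<lambda>n. (cmod (of_nat n * coord x n))\<^sup>2)}"

definition number_op :: "ell2 \<Rightarrow> ell2" where
  "number_op x = Abs_ell2 (\<lambda>n. of_nat n * coord x n)"

definition dirac_dom :: "(ell2 \<times> ell2) set" where
  "dirac_dom = number_dom \<times> number_dom"

definition dirac_op :: "ell2 \<times> ell2 \<Rightarrow> ell2 \<times> ell2" where
  "dirac_op x = (number_op (snd x), number_op (fst x))"

section \<open>The Podles sphere\<close>

definition podles_relations ::
    "real \<Rightarrow> real \<Rightarrow> 'a::complex_star_algebra \<Rightarrow> 'a \<Rightarrow> 'a \<Rightarrow> bool" where
  "podles_relations q c e a b \<longleftrightarrow>
     star a = a \<and>
     star b * b = a - a * a + of_real c *\<^sub>C e \<and>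
     b * a = of_real (q\<^sup>2) *\<^sub>C (a * b) \<and>
     b * star b = of_real (q\<^sup>2) *\<^sub>C a - of_real (q ^ 4) *\<^sub>C (a * a) + of_real c *\<^sub>C e"

instantiation "fun" :: (type, complex_module) complex_module
begin

definition scaleC_fun :: "complex \<Rightarrow> ('a \<Rightarrow> 'b) \<Rightarrow> 'a \<Rightarrow> 'b" where
  "a *\<^sub>C f = (\<lambda>x. a *\<^sub>C f x)"

instance
  by standard (simp_all add: scaleC_fun_def fun_eq_iff scaleC_add_left scaleC_add_right
      scaleC_scaleC scaleC_one)

end

instantiation "fun" :: (type, complex_star_algebra) complex_star_algebra
begin

definition star_fun :: "('a \<Rightarrow> 'b) \<Rightarrow> 'a \<Rightarrow> 'b" where
  "star f = (\<lambda>x. star (f x))"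

instance
  by standard (simp_all add: star_fun_def scaleC_fun_def fun_eq_iff scaleC_mult_left
      scaleC_mult_right star_star star_add star_scaleC star_mult)

end

text \<open>The universal C*-algebra given by the generators and relations is realised in the usual
  way, as the closed *-algebra generated by the generators in the direct product of all their
  representations, with the supremum norm.  The algebra is separable, so representations by
  operators on \<open>\<ell>\<^sup>2\<close> suffice for the universal norm: cyclic representations live on separable
  spaces, and finite-dimensional ones can be amplified.  Elements of the product are functions on
  all pairs of operators, vanishing at pairs that do not satisfy the relations.\<close>

type_synonym podles_elem = "ell2 bop \<times> ell2 bop \<Rightarrow> ell2 bop"

definition podles_pairs :: "real \<Rightarrow> real \<Rightarrow> (ell2 bop \<times> ell2 bop) set" where
  "podles_pairs q c = {(S, T). podles_relations q c 1 S T}"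

definition podles_I :: "real \<Rightarrow> real \<Rightarrow> podles_elem" where
  "podles_I q c r = (if r \<in> podles_pairs q c then 1 else 0)"

definition podles_A :: "real \<Rightarrow> real \<Rightarrow> podles_elem" where
  "podles_A q c r = (if r \<in> podles_pairs q c then fst r else 0)"

definition podles_B :: "real \<Rightarrow> real \<Rightarrow> podles_elem" where
  "podles_B q c r = (if r \<in> podles_pairs q c then snd r else 0)"

definition podles_sphere :: "real \<Rightarrow> real \<Rightarrow> podles_elem set" where
  "podles_sphere q c =
     {x. \<forall>\<epsilon>>0. \<exists>y \<in> star_generated {podles_I q c, podles_A q c, podles_B q c}.
           \<forall>r. onorm (app (x r - y r)) \<le> \<epsilon>}"

definition podles_fin :: "real \<Rightarrow> real \<Rightarrow> podles_elem set" where
  "podles_fin q c =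
     \<Inter>{S. star_subalgebra S \<and> S \<subseteq> podles_sphere q c \<and> {podles_A q c, podles_B q c} \<subseteq> S}"

lemma podles_relations_generators:
  "podles_relations q c (podles_I q c) (podles_A q c) (podles_B q c)"
proof -
  have "fst r = star (fst r)"
    "star (snd r) * snd r = fst r - fst r * fst r + of_real c *\<^sub>C 1"
    "snd r * fst r = of_real (q\<^sup>2) *\<^sub>C (fst r * snd r)"
    "snd r * star (snd r) = of_real (q\<^sup>2) *\<^sub>C fst r - of_real (q ^ 4) *\<^sub>C (fst r * fst r) + of_real c *\<^sub>C 1"
    if "r \<in> podles_pairs q c" for r
    using that by (auto simp: podles_pairs_def podles_relations_def)
  moreover have "star (0::ell2 bop) = 0"
    using star_scaleC[of 0 "0::ell2 bop"] by (simp add: scaleC_zero_left)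
  ultimately show ?thesis
    by (auto simp: podles_relations_def podles_I_def podles_A_def podles_B_def fun_eq_iff
        star_fun_def scaleC_fun_def scaleC_zero_right)
qed

lemma podles_evaluation:
  assumes "podles_relations q c 1 S T"
  shows "star_hom_on (podles_sphere q c) (\<lambda>x. x (S, T))"
    "podles_I q c (S, T) = 1" "podles_A q c (S, T) = S" "podles_B q c (S, T) = T"
  using assms by (auto simp: star_hom_on_def star_fun_def scaleC_fun_def podles_pairs_def
      podles_I_def podles_A_def podles_B_def)

text \<open>In the following, \<open>s = 1\<close> and \<open>s = - 1\<close> select the two representations.\<close>

definition podles_lambda :: "real \<Rightarrow> real \<Rightarrow> real" where
  "podles_lambda s c = 1/2 + s * sqrt (c + 1/4)"

definition podles_coeff :: "real \<Rightarrow> real \<Rightarrow> real \<Rightarrow> nat \<Rightarrow> real" where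
  "podles_coeff s q c n =
     podles_lambda s c * q ^ (2 * n) - (podles_lambda s c * q ^ (2 * n))\<^sup>2 + c"

definition podles_rep_A :: "real \<Rightarrow> real \<Rightarrow> real \<Rightarrow> ell2 bop" where
  "podles_rep_A s q c =
     (THE S. \<forall>n. app S (basis_vec n) = of_real (podles_lambda s c * q ^ (2 * n)) *\<^sub>C basis_vec n)"

definition podles_rep_B :: "real \<Rightarrow> real \<Rightarrow> real \<Rightarrow> ell2 bop" where
  "podles_rep_B s q c =
     (THE T. \<forall>n. app T (basis_vec n) =
        (if n = 0 then 0 else of_real (sqrt (podles_coeff s q c n)) *\<^sub>C basis_vec (n - 1)))"

text \<open>The representation that the universal property assigns to this pair of operators.\<close>

definition podles_rep :: "real \<Rightarrow> real \<Rightarrow> real \<Rightarrow> podles_elem \<Rightarrow> ell2 bop" where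
  "podles_rep s q c x = x (podles_rep_A s q c, podles_rep_B s q c)"

definition podles_pi :: "real \<Rightarrow> real \<Rightarrow> podles_elem \<Rightarrow> (ell2 \<times> ell2) bop" where
  "podles_pi q c x = dsum (podles_rep 1 q c x) (podles_rep (- 1) q c x)"

lemma cinner_basis_left: "cinner (basis_vec n) x = coord x n"
proof -
  have "(\<lambda>m. cnj (coord (basis_vec n) m) * coord x m) = (\<lambda>m. if m = n then coord x m else 0)"
    by (auto simp: basis_vec.rep_eq)
  then show ?thesis by (simp add: cinner_ell2_def sums_unique[OF sums_single, symmetric])
qed

lemma coord_app: "coord (app T x) m = cinner (app (star T) (basis_vec m)) x"
  by (simp add: cinner_basis_left[symmetric] cinner_star')

lemma bop_eq_basis:
  assumes "\<And>n. app S (basis_vec n) = app T (basis_vec n)"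
  shows "S = T"
proof (rule bop_eqI, rule ell2_eqI)
  fix x m
  have "app (star S) (basis_vec m) = app (star T) (basis_vec m)"
    by (rule ell2_eqI) (simp add: cinner_basis_left[symmetric] cinner_star[symmetric] assms)
  then show "coord (app S x) m = coord (app T x) m" by (simp add: coord_app)
qed

lemma weighted_shift_exists:
  assumes w: "\<And>n. cmod (w n) \<le> K"
  shows "\<exists>T. \<forall>x n. coord (app T x) n = w n * coord x (n + k)"
proof -
  have K: "0 \<le> K" using w[of 0] norm_ge_zero order_trans by blast
  have sh: "summable (\<lambda>n. (cmod (coord x (n + k)))\<^sup>2)" for x
    using coord_square_summable[of x] by (rule summable_ignore_initial_segment)
  have sq: "summable (\<lambda>n. (cmod (w n * coord x (n + k)))\<^sup>2)" for x
    by (rule square_summable_bounded_mult[OF sh w])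
  define f where "f x = Abs_ell2 (\<lambda>n. w n * coord x (n + k))" for x
  have f: "coord (f x) n = w n * coord x (n + k)" for x n
    by (simp add: f_def Abs_ell2_inverse sq)
  have "norm (f x) \<le> norm x * K" for x
  proof -
    have "(norm (f x))\<^sup>2 = (\<Sum>n. (cmod (w n * coord x (n + k)))\<^sup>2)"
      by (simp add: norm_ell2_power2 f)
    also have "\<dots> \<le> (\<Sum>n. K\<^sup>2 * (cmod (coord x (n + k)))\<^sup>2)"
      by (rule suminf_le) (auto simp: norm_mult power_mult_distrib w sh summable_mult
          intro!: mult_right_mono power_mono sq[simplified norm_mult power_mult_distrib])
    also have "\<dots> = K\<^sup>2 * (\<Sum>n. (cmod (coord x (n + k)))\<^sup>2)" by (rule suminf_mult[OF sh])
    also have "\<dots> \<le> K\<^sup>2 * (norm x)\<^sup>2"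
      unfolding norm_ell2_power2 suminf_split_initial_segment[OF coord_square_summable, of x k]
      by (intro mult_left_mono) (simp_all add: sum_nonneg)
    finally have "(norm (f x))\<^sup>2 \<le> (norm x * K)\<^sup>2" by (simp add: power_mult_distrib mult.commute)
    then show ?thesis by (rule power2_le_imp_le) (simp add: K)
  qed
  moreover have "f (a *\<^sub>C x) = a *\<^sub>C f x" for a x
    by (rule ell2_eqI) (simp add: f scaleC_ell2.rep_eq)
  moreover have "f (x + y) = f x + f y" for x y
    by (rule ell2_eqI) (simp add: f plus_ell2.rep_eq algebra_simps)
  ultimately have "app (Abs_bop f) = f"
    by (intro Abs_bop_inverse) (auto intro!: bounded_linear_intro simp: scaleC_of_real[symmetric])
  then show ?thesis using f by metis
qed

context
  fixes s q c :: real
  assumes s: "s = 1 \<or> s = - 1" and q: "\<bar>q\<bar> < 1" and c: "c > 0"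
begin

lemma q_power_even: "0 \<le> q ^ (2 * n)" "q ^ (2 * n) \<le> 1"
  using q by (simp_all add: power_mult abs_square_le_1 power_le_one)

lemma podles_coeff_0: "podles_coeff s q c 0 = 0"
proof -
  have "(sqrt (c + 1/4))\<^sup>2 = c + 1/4" using c by simp
  then show ?thesis
    using s by (auto simp: podles_coeff_def podles_lambda_def power2_eq_square algebra_simps)
qed

lemma podles_coeff_nonneg: "0 \<le> podles_coeff s q c n"
  and podles_coeff_le: "podles_coeff s q c n \<le> c + 1/4"
proof -
  define t where "t = sqrt (c + 1/4)"
  define x where "x = q ^ (2 * n)"
  define y where "y = podles_lambda s c * x - 1/2"
  have t: "t\<^sup>2 = c + 1/4" "t > 0"
    using c by (simp_all add: t_def)
  have t_ge: "t \<ge> 1/2"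
    unfolding t_def by (rule real_le_rsqrt) (use c in \<open>simp add: power2_eq_square\<close>)
  have x: "0 \<le> x" "x \<le> 1" using q_power_even by (auto simp: x_def)
  have eq: "podles_coeff s q c n = t\<^sup>2 - y\<^sup>2"
    unfolding podles_coeff_def x_def[symmetric] y_def t(1)
    by (simp add: power2_eq_square algebra_simps)
  have tx: "0 \<le> t * x" "t * x \<le> t" using t x by (auto simp: mult_left_le)
  have "y = x / 2 + s * (t * x) - 1/2"
    by (simp add: y_def podles_lambda_def t_def algebra_simps)
  then have "y = x / 2 + t * x - 1/2 \<or> y = x / 2 - t * x - 1/2" using s by auto
  moreover have "0 \<le> (1 - x) * (t - 1/2)" using x t_ge by simp
  then have "0 \<le> t - 1/2 - t * x + x / 2" by (simp add: field_simps)
  ultimately have "\<bar>y\<bar> \<le> t" using tx t_ge x unfolding abs_le_iff by linarith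
  then have "y\<^sup>2 \<le> t\<^sup>2" by (simp add: abs_le_square_iff[symmetric])
  then show "0 \<le> podles_coeff s q c n" "podles_coeff s q c n \<le> c + 1/4" by (simp_all add: eq t)
qed

lemma podles_rep_A_basis:
  "app (podles_rep_A s q c) (basis_vec n) = of_real (podles_lambda s c * q ^ (2 * n)) *\<^sub>C basis_vec n"
proof -
  have "cmod (of_real (podles_lambda s c * q ^ (2 * n))) \<le> \<bar>podles_lambda s c\<bar>" for n
    using q_power_even[of n] by (simp add: abs_mult mult_left_le del: of_real_mult of_real_power)
  from weighted_shift_exists[where w = "\<lambda>n. of_real (podles_lambda s c * q ^ (2 * n))" and k = 0, OF this]
  obtain T :: "ell2 bop"
    where T: "\<And>x n. coord (app T x) n = of_real (podles_lambda s c * q ^ (2 * n)) * coord x (n + 0)"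
    by blast
  have "\<forall>n. app T (basis_vec n) = of_real (podles_lambda s c * q ^ (2 * n)) *\<^sub>C basis_vec n"
    by (auto intro!: ell2_eqI simp: T scaleC_ell2.rep_eq basis_vec.rep_eq)
  then have "\<exists>!S. \<forall>n. app S (basis_vec n) = of_real (podles_lambda s c * q ^ (2 * n)) *\<^sub>C basis_vec n"
    by (intro ex1I[of _ T]) (auto intro: bop_eq_basis)
  from theI'[OF this] show ?thesis unfolding podles_rep_A_def by blast
qed

lemma podles_rep_B_basis:
  "app (podles_rep_B s q c) (basis_vec n) =
     (if n = 0 then 0 else of_real (sqrt (podles_coeff s q c n)) *\<^sub>C basis_vec (n - 1))"
proof -
  have "cmod (of_real (sqrt (podles_coeff s q c (n + 1)))) \<le> sqrt (c + 1/4)" for n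
    using podles_coeff_nonneg podles_coeff_le by simp
  from weighted_shift_exists[where w = "\<lambda>n. of_real (sqrt (podles_coeff s q c (n + 1)))" and k = 1, OF this]
  obtain T :: "ell2 bop"
    where T: "\<And>x n. coord (app T x) n = of_real (sqrt (podles_coeff s q c (n + 1))) * coord x (n + 1)"
    by blast
  have "\<forall>n. app T (basis_vec n) =
      (if n = 0 then 0 else of_real (sqrt (podles_coeff s q c n)) *\<^sub>C basis_vec (n - 1))"
    by (auto intro!: ell2_eqI simp: T scaleC_ell2.rep_eq basis_vec.rep_eq zero_ell2.rep_eq)
  then have "\<exists>!S. \<forall>n. app S (basis_vec n) =
      (if n = 0 then 0 else of_real (sqrt (podles_coeff s q c n)) *\<^sub>C basis_vec (n - 1))"
    by (intro ex1I[of _ T]) (auto intro: bop_eq_basis)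
  from theI'[OF this] show ?thesis unfolding podles_rep_B_def by blast
qed

lemma star_podles_rep_B_basis:
  "app (star (podles_rep_B s q c)) (basis_vec n) =
     of_real (sqrt (podles_coeff s q c (n + 1))) *\<^sub>C basis_vec (n + 1)"
proof (rule ell2_eqI)
  fix m
  have "coord (app (star (podles_rep_B s q c)) (basis_vec n)) m =
      cinner (app (podles_rep_B s q c) (basis_vec m)) (basis_vec n)"
    by (simp add: cinner_basis_left[symmetric] cinner_star)
  also have "\<dots> = coord (of_real (sqrt (podles_coeff s q c (n + 1))) *\<^sub>C basis_vec (n + 1)) m"
  proof (cases "m = 0")
    case True
    then show ?thesis
      by (simp add: podles_rep_B_basis scaleC_ell2.rep_eq basis_vec.rep_eq cinner_ell2_def
          zero_ell2.rep_eq)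
  next
    case False
    then show ?thesis
      by (auto simp: podles_rep_B_basis scaleC_ell2.rep_eq cinner_scaleC_left cinner_basis_left
          basis_vec.rep_eq)
  qed
  finally show "coord (app (star (podles_rep_B s q c)) (basis_vec n)) m =
      coord (of_real (sqrt (podles_coeff s q c (n + 1))) *\<^sub>C basis_vec (n + 1)) m" .
qed

lemma podles_rep_relations:
  "podles_relations q c 1 (podles_rep_A s q c) (podles_rep_B s q c)"
proof -
  note ops = times_bop.rep_eq plus_bop.rep_eq minus_bop.rep_eq scaleC_bop.rep_eq one_bop.rep_eq
    app_scaleC podles_rep_A_basis podles_rep_B_basis star_podles_rep_B_basis
  note coords = scaleC_ell2.rep_eq plus_ell2.rep_eq minus_ell2.rep_eq basis_vec.rep_eq zero_ell2.rep_eq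
  have sq: "complex_of_real (sqrt (podles_coeff s q c n)) * complex_of_real (sqrt (podles_coeff s q c n))
      = complex_of_real (podles_coeff s q c n)" for n
    by (simp add: of_real_mult[symmetric] podles_coeff_nonneg del: of_real_mult)
  have zero: "app T 0 = 0" for T :: "ell2 bop"
    by (simp add: linear_0 app_bounded_linear bounded_linear.linear)
  have "star (podles_rep_A s q c) = podles_rep_A s q c"
  proof (rule bop_eq_basis, rule ell2_eqI)
    fix n m
    show "coord (app (star (podles_rep_A s q c)) (basis_vec n)) m =
        coord (app (podles_rep_A s q c) (basis_vec n)) m"
      by (simp add: cinner_basis_left[symmetric] cinner_star[symmetric])
        (auto simp: podles_rep_A_basis cinner_scaleC_left cinner_basis_left coords)
  qed
  moreover have "star (podles_rep_B s q c) * podles_rep_B s q c =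
      podles_rep_A s q c - podles_rep_A s q c * podles_rep_A s q c + of_real c *\<^sub>C 1"
  proof (rule bop_eq_basis, rule ell2_eqI)
    fix n m
    have c0: "podles_lambda s c + c = podles_lambda s c * podles_lambda s c"
      using podles_coeff_0 by (simp add: podles_coeff_def power2_eq_square)
    show "coord (app (star (podles_rep_B s q c) * podles_rep_B s q c) (basis_vec n)) m =
        coord (app (podles_rep_A s q c - podles_rep_A s q c * podles_rep_A s q c + of_real c *\<^sub>C 1)
          (basis_vec n)) m"
    proof (cases "n = 0")
      case True
      have "complex_of_real (podles_lambda s c) + of_real c = of_real (podles_lambda s c) * of_real (podles_lambda s c)"
        using c0 by (metis of_real_add of_real_mult)
      then show ?thesis using True by (simp add: ops coords zero algebra_simps)
    next
      case False
      then show ?thesis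
        by (simp add: ops coords sq) (simp add: podles_coeff_def power2_eq_square algebra_simps)
    qed
  qed
  moreover have "podles_rep_B s q c * podles_rep_A s q c =
      of_real (q\<^sup>2) *\<^sub>C (podles_rep_A s q c * podles_rep_B s q c)"
  proof (rule bop_eq_basis, rule ell2_eqI)
    fix n m
    show "coord (app (podles_rep_B s q c * podles_rep_A s q c) (basis_vec n)) m =
      coord (app (of_real (q\<^sup>2) *\<^sub>C (podles_rep_A s q c * podles_rep_B s q c)) (basis_vec n)) m"
      by (cases n) (simp_all add: ops coords zero power_add power2_eq_square algebra_simps)
  qed
  moreover have "podles_rep_B s q c * star (podles_rep_B s q c) =
      of_real (q\<^sup>2) *\<^sub>C podles_rep_A s q c
      - of_real (q ^ 4) *\<^sub>C (podles_rep_A s q c * podles_rep_A s q c) + of_real c *\<^sub>C 1"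
  proof (rule bop_eq_basis, rule ell2_eqI)
    fix n m
    show "coord (app (podles_rep_B s q c * star (podles_rep_B s q c)) (basis_vec n)) m =
      coord (app (of_real (q\<^sup>2) *\<^sub>C podles_rep_A s q c
        - of_real (q ^ 4) *\<^sub>C (podles_rep_A s q c * podles_rep_A s q c) + of_real c *\<^sub>C 1) (basis_vec n)) m"
      by (simp add: ops coords sq)
        (simp add: podles_coeff_def power_add power2_eq_square power4_eq_xxxx algebra_simps)
  qed
  ultimately show ?thesis by (simp add: podles_relations_def)
qed

end

end

theory Submission
  imports Defs
begin

text \<open>For self-adjoint \<open>D\<close>, the operators that preserve the domain of \<open>D\<close> and have a bounded
  commutator with \<open>D\<close> form a *-algebra: for \<open>b\<^sup>*\<close>, the domain condition follows because the domain
  of \<open>D\<close> equals that of its adjoint.  So the commutators have to be bounded for \<open>A\<close> and \<open>B\<close> only.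
  There the off-diagonal form of \<open>D\<close> requires that \<open>\<pi>\<^sub>+\<close> and \<open>\<pi>\<^sub>-\<close> agree up to \<open>O(1/n)\<close>; this holds
  because \<open>\<lambda>\<^sub>\<plusminus> q\<^sup>2\<^sup>n\<close> tends to \<open>0\<close> and \<open>c\<^sub>\<plusminus>(n)\<^sup>1\<^sup>/\<^sup>2\<close> to \<open>\<surd>c\<close>, both at the rate \<open>q\<^sup>2\<^sup>n\<close>.  Every
  resolvent of \<open>D\<close> is compact because the unit ball for the graph norm of \<open>D\<close> is approximated
  uniformly by truncations to finitely many coordinates.\<close>

section \<open>Star-subalgebras and operators with bounded commutator\<close>

lemma star_subalgebra_Inter:
  "(\<And>S. S \<in> \<S> \<Longrightarrow> star_subalgebra S) \<Longrightarrow> star_subalgebra (\<Inter>\<S>)"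
  unfolding star_subalgebra_def by blast

lemma star_subalgebra_Int:
  "star_subalgebra S \<Longrightarrow> star_subalgebra T \<Longrightarrow> star_subalgebra (S \<inter> T)"
  using star_subalgebra_Inter[of "{S, T}"] by auto

lemma star_subalgebra_generated: "star_subalgebra (star_generated X)"
  unfolding star_generated_def by (rule star_subalgebra_Inter) blast

lemma star_generated_superset: "X \<subseteq> star_generated X"
  unfolding star_generated_def by blast

lemma star_hom_onD:
  assumes "star_hom_on S \<pi>" "x \<in> S"
  shows "y \<in> S \<Longrightarrow> \<pi> (x + y) = \<pi> x + \<pi> y" "y \<in> S \<Longrightarrow> \<pi> (x * y) = \<pi> x * \<pi> y"
    "\<pi> (a *\<^sub>C x) = a *\<^sub>C \<pi> x" "\<pi> (star x) = star (\<pi> x)"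
  using assms by (auto simp: star_hom_on_def)

lemma star_hom_on_subset: "star_hom_on T \<pi> \<Longrightarrow> S \<subseteq> T \<Longrightarrow> star_hom_on S \<pi>"
  unfolding star_hom_on_def by blast

lemma star_subalgebra_vimage:
  assumes "star_hom_on UNIV \<pi>" "star_subalgebra S"
  shows "star_subalgebra (\<pi> -` S)"
proof -
  have "\<pi> 0 = 0"
    using star_hom_onD(3)[OF assms(1), of 0 0] by (simp add: scaleC_zero_left)
  then show ?thesis
    using assms(2) by (simp add: star_subalgebra_def star_hom_onD[OF assms(1)])
qed

text \<open>Stronger than \<open>bounded_commutator\<close>: all of \<open>V\<close> has to be
  preserved. For two operators that map only dense parts of \<open>V\<close> into \<open>V\<close>,
  the parts for their sum and product could fail to be dense.\<close>

definition bounded_commutator_algebra ::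
    "'a::complex_hilbert_space set \<Rightarrow> ('a \<Rightarrow> 'a) \<Rightarrow> 'a bop set" where
  "bounded_commutator_algebra V D =
     {b. (\<forall>x\<in>V. app b x \<in> V) \<and> (\<exists>T. \<forall>x\<in>V. app T x = D (app b x) - app b (D x))}"

lemma bounded_commutator_algebraI:
  assumes "\<And>x. x \<in> V \<Longrightarrow> app b x \<in> V"
    and "\<And>x. x \<in> V \<Longrightarrow> app T x = D (app b x) - app b (D x)"
  shows "b \<in> bounded_commutator_algebra V D"
  unfolding bounded_commutator_algebra_def using assms by blast

lemma bounded_commutatorI:
  assumes "closure V = UNIV" "b \<in> bounded_commutator_algebra V D"
  shows "bounded_commutator V D b"
proof -
  have "{x \<in> V. app b x \<in> V} = V"
    using assms(2) by (auto simp: bounded_commutator_algebra_def)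
  then show ?thesis
    using assms by (auto simp: bounded_commutator_def bounded_commutator_algebra_def)
qed

lemma cinner_diff_right:
  "cinner x (y - z) = cinner x y - cinner (x::'a::complex_hilbert_space) z"
  using cinner_add_right[of x "y - z" z] by simp

lemma cinner_diff_left:
  "cinner (x - y) z = cinner x z - cinner (y::'a::complex_hilbert_space) z"
  using cinner_add_left[of "x - y" y z] by simp

lemma app_diff: "app T (x - y) = app T x - app T y"
  using app_add[of T "x - y" y] by simp

lemma scaleC_diff_right: "a *\<^sub>C (x - y) = a *\<^sub>C x - a *\<^sub>C (y::'a::complex_module)"
  using scaleC_add_right[of a "x - y" y] by simp

text \<open>The commutator is a derivation: if \<open>S\<close> and \<open>T\<close> extend [D, a]
  and [D, b], then \<open>S * b + a * T\<close> extends [D, ab]. For the adjoint, [D, star a] is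
  extended by \<open>- star S\<close>.\<close>

lemma star_subalgebra_bounded_commutator:
  assumes sa: "self_adjoint V D"
  shows "star_subalgebra (bounded_commutator_algebra V D)"
proof -
  have lin: "0 \<in> V" "D 0 = 0"
    "\<And>x y. x \<in> V \<Longrightarrow> y \<in> V \<Longrightarrow> x + y \<in> V \<and> D (x + y) = D x + D y"
    "\<And>a x. x \<in> V \<Longrightarrow> a *\<^sub>C x \<in> V \<and> D (a *\<^sub>C x) = a *\<^sub>C D x"
    using sa unfolding self_adjoint_def linear_operator_def
    by (blast, metis scaleC_zero_left, blast+)
  have sym: "\<And>x y. x \<in> V \<Longrightarrow> y \<in> V \<Longrightarrow> cinner (D x) y = cinner x (D y)"
    and adj: "adjoint_domain V D = V" and dense: "closure V = UNIV"
    using sa unfolding self_adjoint_def by blast+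
  note ops = plus_bop.rep_eq times_bop.rep_eq scaleC_bop.rep_eq zero_bop.rep_eq
  let ?A = "bounded_commutator_algebra V D"
  have "0 \<in> ?A"
    unfolding bounded_commutator_algebra_def
    by (auto intro!: exI[of _ 0] simp: ops lin)
  moreover have "a + b \<in> ?A \<and> a * b \<in> ?A" if ab: "a \<in> ?A" "b \<in> ?A" for a b
  proof -
    obtain S T where
      a: "\<And>x. x \<in> V \<Longrightarrow> app a x \<in> V" "\<And>x. x \<in> V \<Longrightarrow> app S x = D (app a x) - app a (D x)" and
      b: "\<And>x. x \<in> V \<Longrightarrow> app b x \<in> V" "\<And>x. x \<in> V \<Longrightarrow> app T x = D (app b x) - app b (D x)"
      using ab unfolding bounded_commutator_algebra_def by blast
    have sum: "app (S + T) x = D (app (a + b) x) - app (a + b) (D x)" if "x \<in> V" for x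
      using that a b lin by (simp add: ops)
    have "app (a + b) x \<in> V" if "x \<in> V" for x
      using lin(3)[OF a(1)[OF that] b(1)[OF that]] by (simp add: plus_bop.rep_eq)
    from this sum have plus: "a + b \<in> ?A" by (rule bounded_commutator_algebraI)
    have prod: "app (S * b + a * T) x = D (app (a * b) x) - app (a * b) (D x)" if "x \<in> V" for x
      using that a b lin by (simp add: ops app_diff)
    have "app (a * b) x \<in> V" if "x \<in> V" for x
      using a(1)[OF b(1)[OF that]] by (simp add: times_bop.rep_eq)
    from this prod have "a * b \<in> ?A" by (rule bounded_commutator_algebraI)
    with plus show ?thesis by blast
  qed
  moreover have "z *\<^sub>C a \<in> ?A" if ab: "a \<in> ?A" for z a
  proof -
    obtain S where
      a: "\<And>x. x \<in> V \<Longrightarrow> app a x \<in> V" "\<And>x. x \<in> V \<Longrightarrow> app S x = D (app a x) - app a (D x)"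
      using ab unfolding bounded_commutator_algebra_def by blast
    have scale: "app (z *\<^sub>C S) x = D (app (z *\<^sub>C a) x) - app (z *\<^sub>C a) (D x)" if "x \<in> V" for x
      using that a lin by (simp add: ops scaleC_diff_right)
    have "app (z *\<^sub>C a) x \<in> V" if "x \<in> V" for x
      using lin(4)[OF a(1)[OF that]] by (simp add: scaleC_bop.rep_eq)
    from this scale show ?thesis by (rule bounded_commutator_algebraI)
  qed
  moreover have "star a \<in> ?A" if ab: "a \<in> ?A" for a
  proof -
    obtain S where
      a: "\<And>x. x \<in> V \<Longrightarrow> app a x \<in> V" "\<And>x. x \<in> V \<Longrightarrow> app S x = D (app a x) - app a (D x)"
      using ab unfolding bounded_commutator_algebra_def by blast
    \<comment> \<open>The vector on the right does not depend on \<open>x\<close>, so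
      \<open>app (star a) y\<close> belongs to \<open>adjoint_domain V D\<close>, which is
      \<open>V\<close>.\<close>
    have weak: "cinner (D x) (app (star a) y) = cinner x (app (star a) (D y) - app (star S) y)"
      if x: "x \<in> V" and y: "y \<in> V" for x y
    proof -
      have "cinner (D x) (app (star a) y) = cinner (D (app a x) - app S x) y"
        using a(2)[OF x] by (simp add: cinner_star)
      then show ?thesis
        using sym[OF a(1)[OF x] y] by (simp add: cinner_diff_left cinner_diff_right cinner_star)
    qed
    have dom: "app (star a) y \<in> V" if "y \<in> V" for y
      using weak[OF _ that] adj unfolding adjoint_domain_def by blast
    have "D (app (star a) y) = app (star a) (D y) - app (star S) y" if y: "y \<in> V" for y
    proof -
      let ?d = "D (app (star a) y) - (app (star a) (D y) - app (star S) y)"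
      have "cinner x ?d = 0" if "x \<in> V" for x
        using sym[OF that dom[OF y]] weak[OF that y] by (simp add: cinner_diff_right)
      then have "inner x ?d = 0" if "x \<in> V" for x
        using that by (simp only: inner_eq_Re_cinner zero_complex.sel)
      \<comment> \<open>The vectors orthogonal to \<open>?d\<close> in the real inner product form a
        closed hyperplane. It contains the dense set \<open>V\<close>, hence \<open>?d\<close>
        itself.\<close>
      then have "V \<subseteq> {x. inner ?d x = 0}"
        by (simp only: inner_commute[of ?d] subset_iff mem_Collect_eq) blast
      then have "closure V \<subseteq> {x. inner ?d x = 0}"
        by (intro closure_minimal closed_hyperplane)
      then have "inner ?d ?d = 0"
        using dense by blast
      then show ?thesis by simp
    qed
    then have "app (- star S) y = D (app (star a) y) - app (star a) (D y)" if "y \<in> V" for y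
      using that by (simp add: uminus_bop.rep_eq)
    with dom show ?thesis by (rule bounded_commutator_algebraI)
  qed
  ultimately show ?thesis
    unfolding star_subalgebra_def by blast
qed

section \<open>A compactness criterion\<close>

lemma compact_closure_if_approximable:
  fixes S :: "'a::complete_space set"
  assumes "\<And>e. e > 0 \<Longrightarrow> \<exists>K. compact K \<and> (\<forall>x\<in>S. \<exists>y\<in>K. dist x y < e)"
  shows "compact (closure S)"
  unfolding compact_eq_totally_bounded
proof (intro conjI allI impI)
  show "complete (closure S)" by (simp add: complete_eq_closed)
  fix e :: real assume e: "e > 0"
  obtain K where K: "compact K" "\<And>x. x \<in> S \<Longrightarrow> \<exists>y\<in>K. dist x y < e / 4"
    using assms[of "e / 4"] e by auto
  obtain F where F: "finite F" "K \<subseteq> (\<Union>x\<in>F. ball x (e / 4))"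
    using K(1) e unfolding compact_eq_totally_bounded by (meson divide_pos_pos zero_less_numeral)
  \<comment> \<open>Three steps of length below \<open>e / 4\<close> lead from a point of the
    closure to \<open>S\<close>, from there to \<open>K\<close>, and from there to the finite net
    \<open>F\<close> of \<open>K\<close>.\<close>
  have "closure S \<subseteq> (\<Union>x\<in>F. ball x e)"
  proof
    fix x assume "x \<in> closure S"
    then obtain s where s: "s \<in> S" "dist s x < e / 4"
      using e by (meson closure_approachable divide_pos_pos zero_less_numeral)
    obtain y where y: "y \<in> K" "dist s y < e / 4" using K(2)[OF s(1)] by blast
    obtain f where f: "f \<in> F" "dist f y < e / 4" using F(2) y(1) by auto
    have "dist f x \<le> dist f y + dist s y + dist s x"
      using dist_triangle[of f x y] dist_triangle[of y x s] by (simp add: dist_commute)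
    then have "dist f x < e" using s y f e by linarith
    then show "x \<in> (\<Union>x\<in>F. ball x e)" using f(1) by auto
  qed
  then show "\<exists>k. finite k \<and> closure S \<subseteq> (\<Union>x\<in>k. ball x e)" using F(1) by blast
qed

section \<open>Truncations, the number operator and self-adjointness of D\<close>

lemmas ell2_coords = scaleC_ell2.rep_eq plus_ell2.rep_eq minus_ell2.rep_eq zero_ell2.rep_eq

lemma norm_scaleC_basis_vec [simp]: "norm (a *\<^sub>C basis_vec n) = cmod a"
proof -
  have "cinner (basis_vec n) (basis_vec n) = 1"
    by (simp add: cinner_basis_left basis_vec.rep_eq)
  then have "norm (basis_vec n) = 1"
    by (simp add: norm_eq_sqrt_inner inner_eq_Re_cinner)
  then show ?thesis by (simp add: norm_scaleC)
qed

definition trunc :: "nat \<Rightarrow> ell2 \<Rightarrow> ell2" where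
  "trunc M x = (\<Sum>n<M. coord x n *\<^sub>C basis_vec n)"

lemma coord_trunc: "coord (trunc M x) m = (if m < M then coord x m else 0)"
  by (induction M) (auto simp: trunc_def ell2_coords basis_vec.rep_eq less_Suc_eq)

lemma trunc_tendsto: "(\<lambda>M. trunc M x) \<longlonglongrightarrow> x"
proof -
  \<comment> \<open>Pythagoras: the squared error is the tail of the series for the squared norm of
    \<open>x\<close>.\<close>
  have eq: "(norm (trunc M x - x))\<^sup>2 = (norm x)\<^sup>2 - (\<Sum>n<M. (cmod (coord x n))\<^sup>2)" for M
  proof -
    have "(norm (trunc M x - x))\<^sup>2 =
        (\<Sum>n. (cmod (coord (trunc M x - x) (n + M)))\<^sup>2) + (\<Sum>n<M. (cmod (coord (trunc M x - x) n))\<^sup>2)"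
      unfolding norm_ell2_power2 by (rule suminf_split_initial_segment[OF coord_square_summable])
    also have "\<dots> = (\<Sum>n. (cmod (coord x (n + M)))\<^sup>2)"
      by (simp add: ell2_coords coord_trunc)
    finally show ?thesis
      unfolding norm_ell2_power2[of x]
      by (simp add: suminf_split_initial_segment[OF coord_square_summable, of x M])
  qed
  have "(\<lambda>M. (norm x)\<^sup>2 - (\<Sum>n<M. (cmod (coord x n))\<^sup>2)) \<longlonglongrightarrow> (norm x)\<^sup>2 - (norm x)\<^sup>2"
    unfolding norm_ell2_power2
    by (intro tendsto_diff tendsto_const summable_LIMSEQ coord_square_summable)
  then have "(\<lambda>M. sqrt ((norm (trunc M x - x))\<^sup>2)) \<longlonglongrightarrow> sqrt 0"
    by (intro tendsto_real_sqrt) (simp add: eq)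
  then have "(\<lambda>M. norm (trunc M x - x)) \<longlonglongrightarrow> 0" by simp
  then show ?thesis
    by (rule LIM_zero_cancel[OF tendsto_norm_zero_cancel])
qed

lemma number_domD:
  assumes "x \<in> number_dom"
  shows "coord (number_op x) n = of_nat n * coord x n"
  using assms by (simp add: number_op_def number_dom_def Abs_ell2_inverse)

text \<open>Naming the image \<open>y\<close> as an element of \<open>ell2\<close> supplies the
  summability, so domain membership becomes an identity of coordinates.\<close>

lemma number_domI:
  assumes "\<And>n. coord y n = of_nat n * coord x n"
  shows "x \<in> number_dom"
  using coord_square_summable[of y] by (simp add: number_dom_def assms)

lemma number_op_eqI:
  assumes "\<And>n. coord y n = of_nat n * coord x n"
  shows "number_op x = y"
  by (rule ell2_eqI) (simp add: number_domD[OF number_domI, OF assms] assms)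

lemma number_dom_linear:
  "0 \<in> number_dom" "number_op 0 = 0"
  "x \<in> number_dom \<Longrightarrow> y \<in> number_dom \<Longrightarrow> x + y \<in> number_dom \<and> number_op (x + y) = number_op x + number_op y"
  "x \<in> number_dom \<Longrightarrow> a *\<^sub>C x \<in> number_dom \<and> number_op (a *\<^sub>C x) = a *\<^sub>C number_op x"
proof -
  have "coord 0 n = of_nat n * coord 0 n" for n by (simp add: ell2_coords)
  then show "0 \<in> number_dom" "number_op 0 = 0" by (rule number_domI, intro number_op_eqI)
next
  assume "x \<in> number_dom" "y \<in> number_dom"
  then have "coord (number_op x + number_op y) n = of_nat n * coord (x + y) n" for n
    by (simp add: ell2_coords number_domD algebra_simps)
  then show "x + y \<in> number_dom \<and> number_op (x + y) = number_op x + number_op y"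
    by (intro conjI number_domI number_op_eqI)
next
  assume "x \<in> number_dom"
  then have "coord (a *\<^sub>C number_op x) n = of_nat n * coord (a *\<^sub>C x) n" for n
    by (simp add: ell2_coords number_domD algebra_simps)
  then show "a *\<^sub>C x \<in> number_dom \<and> number_op (a *\<^sub>C x) = a *\<^sub>C number_op x"
    by (intro conjI number_domI number_op_eqI)
qed

lemma number_dom_basis_vec:
  "basis_vec n \<in> number_dom" "number_op (basis_vec n) = of_nat n *\<^sub>C basis_vec n"
proof -
  have "coord (of_nat n *\<^sub>C basis_vec n) m = of_nat m * coord (basis_vec n) m" for m
    by (simp add: ell2_coords basis_vec.rep_eq)
  then show "basis_vec n \<in> number_dom" "number_op (basis_vec n) = of_nat n *\<^sub>C basis_vec n"
    by (rule number_domI, intro number_op_eqI)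
qed

lemma number_dom_dense: "closure number_dom = UNIV"
proof -
  have "trunc M x \<in> number_dom" for M x
    by (induction M) (simp_all add: trunc_def number_dom_linear number_dom_basis_vec)
  then have "x \<in> closure number_dom" for x
    unfolding closure_sequential using trunc_tendsto by (intro exI[of _ "\<lambda>M. trunc M x"]) simp
  then show ?thesis by blast
qed

lemma number_op_symmetric:
  assumes "x \<in> number_dom" "y \<in> number_dom"
  shows "cinner (number_op x) y = cinner x (number_op y)"
  unfolding cinner_ell2_def using assms by (simp add: number_domD mult.assoc mult.left_commute)

text \<open>The domain is maximal: testing \<open>y\<close> in the adjoint domain against basis
  vectors of either summand shows that \<open>n\<close> times the coordinates of
  \<open>snd y\<close> and \<open>fst y\<close> are those of \<open>fst z\<close> and
  \<open>snd z\<close>, hence square-summable.\<close>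

lemma dirac_self_adjoint: "self_adjoint dirac_dom dirac_op"
  unfolding self_adjoint_def
proof (intro conjI ballI)
  show "linear_operator dirac_dom dirac_op"
    by (auto simp: linear_operator_def dirac_dom_def dirac_op_def number_dom_linear scaleC_prod_def
        zero_prod_def)
  show "closure dirac_dom = UNIV"
    by (simp add: dirac_dom_def closure_Times number_dom_dense)
  show sym: "cinner (dirac_op x) y = cinner x (dirac_op y)"
    if "x \<in> dirac_dom" "y \<in> dirac_dom" for x y
    using that by (auto simp: dirac_dom_def dirac_op_def cinner_prod_def number_op_symmetric)
  show "adjoint_domain dirac_dom dirac_op = dirac_dom"
  proof
    show "dirac_dom \<subseteq> adjoint_domain dirac_dom dirac_op"
      using sym unfolding adjoint_domain_def by blast
    show "adjoint_domain dirac_dom dirac_op \<subseteq> dirac_dom"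
    proof
      fix y assume "y \<in> adjoint_domain dirac_dom dirac_op"
      then obtain z where z: "\<And>x. x \<in> dirac_dom \<Longrightarrow> cinner (dirac_op x) y = cinner x z"
        unfolding adjoint_domain_def by blast
      have zero: "cinner 0 x = 0" for x :: ell2
        using cinner_scaleC_left[of 0 0 x] by (simp add: scaleC_zero_left)
      note simps = dirac_dom_def dirac_op_def cinner_prod_def number_dom_linear number_dom_basis_vec
        cinner_scaleC_left cinner_basis_left zero
      have "coord (fst z) n = of_nat n * coord (snd y) n" for n
        using z[of "(basis_vec n, 0)"] by (simp add: simps)
      moreover have "coord (snd z) n = of_nat n * coord (fst y) n" for n
        using z[of "(0, basis_vec n)"] by (simp add: simps)
      ultimately have "snd y \<in> number_dom" "fst y \<in> number_dom"
        by (auto intro: number_domI)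
      then show "y \<in> dirac_dom" by (simp add: dirac_dom_def mem_Times_iff)
    qed
  qed
qed

section \<open>Compactness of the resolvents\<close>

lemma truncations_in_compact:
  "\<exists>K. compact K \<and> (\<forall>x. norm x \<le> C \<longrightarrow> trunc M x \<in> K)"
proof (induction M)
  case 0
  show ?case by (intro exI[of _ "{0}"]) (simp add: trunc_def)
next
  case (Suc M)
  then obtain K where K: "compact K" "\<And>x. norm x \<le> C \<Longrightarrow> trunc M x \<in> K" by blast
  have "bounded_linear (\<lambda>a. a *\<^sub>C basis_vec M)"
    by (rule bounded_linear_intro[where K = 1])
      (simp_all add: scaleC_add_left scaleC_of_real[symmetric] scaleC_scaleC scaleR_conv_of_real)
  \<comment> \<open>The compact set grows by one coordinate at a time: coordinate \<open>M\<close>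
    ranges over the disc of radius \<open>C\<close>, and adding its contribution is
    continuous.\<close>
  then have "continuous_on UNIV (\<lambda>p. fst p + snd p *\<^sub>C basis_vec M)"
    by (intro continuous_intros bounded_linear.continuous_on[of "\<lambda>a. a *\<^sub>C basis_vec M"])
  then have "compact ((\<lambda>p. fst p + snd p *\<^sub>C basis_vec M) ` (K \<times> cball 0 C))"
    by (intro compact_continuous_image compact_Times K compact_cball) (rule continuous_on_subset, auto)
  moreover have "trunc (Suc M) x \<in> (\<lambda>p. fst p + snd p *\<^sub>C basis_vec M) ` (K \<times> cball 0 C)"
    if "norm x \<le> C" for x
    using K(2)[OF that] norm_coord_le[of x M] that
    by (intro image_eqI[of _ _ "(trunc M x, coord x M)"]) (auto simp: trunc_def)
  ultimately show ?case by blast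
qed

text \<open>Only coordinates with index at least \<open>M\<close> survive in the difference, and
  there the weight of \<open>number_op\<close> is at least \<open>M\<close>.\<close>

lemma norm_trunc_diff_le:
  assumes "x \<in> number_dom"
  shows "real M * norm (x - trunc M x) \<le> norm (number_op x)"
proof -
  have "(real M * norm (x - trunc M x))\<^sup>2 = (\<Sum>n. (real M)\<^sup>2 * (cmod (coord (x - trunc M x) n))\<^sup>2)"
    unfolding power_mult_distrib norm_ell2_power2
    by (rule suminf_mult[symmetric, OF coord_square_summable])
  also have "\<dots> \<le> (\<Sum>n. (cmod (coord (number_op x) n))\<^sup>2)"
  proof (rule suminf_le)
    fix n
    show "(real M)\<^sup>2 * (cmod (coord (x - trunc M x) n))\<^sup>2 \<le> (cmod (coord (number_op x) n))\<^sup>2"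
      using assms by (auto simp: ell2_coords coord_trunc number_domD norm_mult power_mult_distrib
          intro!: mult_right_mono power_mono)
  qed (intro summable_mult coord_square_summable)+
  also have "\<dots> = (norm (number_op x))\<^sup>2" by (simp add: norm_ell2_power2)
  finally show ?thesis by (rule power2_le_imp_le) simp
qed

text \<open>Once \<open>C < real M * e\<close>, truncation at \<open>M\<close> moves every point of
  the set by less than \<open>e\<close>, and the truncations lie in one compact set.\<close>

lemma number_op_graph_ball_compact:
  "compact (closure {x \<in> number_dom. norm x \<le> C \<and> norm (number_op x) \<le> C})"
proof (rule compact_closure_if_approximable)
  fix e :: real assume e: "e > 0"
  obtain M :: nat where M: "C < real M * e"
    using ex_less_of_nat_mult[OF e] by blast
  obtain K where K: "compact K" "\<And>x. norm x \<le> C \<Longrightarrow> trunc M x \<in> K"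
    using truncations_in_compact by blast
  have "dist x (trunc M x) < e" if "x \<in> number_dom" "norm (number_op x) \<le> C" for x
  proof -
    have "real M * norm (x - trunc M x) < real M * e"
      using norm_trunc_diff_le[OF that(1), of M] that(2) M by linarith
    then show ?thesis by (simp add: dist_norm mult_less_cancel_left)
  qed
  then show "\<exists>K. compact K \<and>
      (\<forall>x\<in>{x \<in> number_dom. norm x \<le> C \<and> norm (number_op x) \<le> C}. \<exists>y\<in>K. dist x y < e)"
    using K by blast
qed

text \<open>On the unit ball, \<open>app R x\<close> is bounded by \<open>K\<close>, and D R x = x +
  z R x by 1 + |z| K. So both components of \<open>app R x\<close> stay in a ball for the graph norm
  of the number operator.\<close>

lemma dirac_resolvent_compact:
  assumes R: "is_resolvent dirac_dom dirac_op z R"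
  shows "compact_bop R"
proof -
  obtain K where K: "\<And>x. norm (app R x) \<le> norm x * K" "K \<ge> 0"
    using bounded_linear.nonneg_bounded[OF app_bounded_linear[of R]] by blast
  define C where "C = 1 + K + cmod z * K"
  let ?E = "{x \<in> number_dom. norm x \<le> C \<and> norm (number_op x) \<le> C}"
  have "app R x \<in> ?E \<times> ?E" if x: "x \<in> ball 0 1" for x
  proof -
    let ?y = "app R x"
    have y: "?y \<in> dirac_dom" "dirac_op ?y - z *\<^sub>C ?y = x"
      using R unfolding is_resolvent_def by blast+
    have x1: "norm x \<le> 1" using x by simp
    have ny: "norm ?y \<le> K"
      using K(1)[of x] mult_right_mono[OF x1 K(2)] by simp
    have "norm (dirac_op ?y) = norm (x + z *\<^sub>C ?y)"
      using y(2) by (metis diff_add_cancel)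
    also have "\<dots> \<le> 1 + cmod z * K"
      using x1 ny by (intro norm_triangle_le add_mono) (auto simp: norm_scaleC intro: mult_left_mono)
    finally have nD: "norm (dirac_op ?y) \<le> 1 + cmod z * K" .
    have "norm (fst ?y) \<le> norm ?y" "norm (snd ?y) \<le> norm ?y"
      "norm (number_op (fst ?y)) \<le> norm (dirac_op ?y)" "norm (number_op (snd ?y)) \<le> norm (dirac_op ?y)"
      using norm_fst_le[of "fst ?y" "snd ?y"] norm_snd_le[of "snd ?y" "fst ?y"]
        norm_fst_le[of "fst (dirac_op ?y)" "snd (dirac_op ?y)"]
        norm_snd_le[of "snd (dirac_op ?y)" "fst (dirac_op ?y)"]
      by (simp_all add: dirac_op_def)
    moreover have "K \<le> C" "1 + cmod z * K \<le> C" using K(2) by (auto simp: C_def)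
    ultimately show ?thesis
      using y(1) ny nD by (auto simp: dirac_dom_def mem_Times_iff)
  qed
  then have "closure (app R ` ball 0 1) \<subseteq> closure (?E \<times> ?E)"
    by (intro closure_mono) blast
  then have "closure (?E \<times> ?E) \<inter> closure (app R ` ball 0 1) = closure (app R ` ball 0 1)"
    by blast
  moreover have "compact (closure (?E \<times> ?E))"
    unfolding closure_Times by (intro compact_Times number_op_graph_ball_compact)
  then have "compact (closure (?E \<times> ?E) \<inter> closure (app R ` ball 0 1))"
    by (rule compact_Int_closed) simp
  ultimately show ?thesis
    unfolding compact_bop_def by (simp only:)
qed

section \<open>Existence of a resolvent\<close>

lift_definition dsum_off ::
    "'b::complex_hilbert_space bop \<Rightarrow> 'b bop \<Rightarrow> ('b \<times> 'b) bop"
  is "\<lambda>S T x. (S (snd x), T (fst x))"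
  by (auto simp: scaleC_prod_def intro!: bounded_linear_Pair
      intro: bounded_linear_compose bounded_linear_fst bounded_linear_snd)

text \<open>\<open>(D - i)\<^sup>-\<^sup>1 = (D + i) (D\<^sup>2 + 1)\<^sup>-\<^sup>1\<close>, where \<open>D\<^sup>2 = N\<^sup>2 \<oplus> N\<^sup>2\<close>.\<close>

lemma dirac_resolvent_exists: "\<exists>R. is_resolvent dirac_dom dirac_op \<i> R"
proof -
  \<comment> \<open>The eigenvalue of (N^2 + 1)^-1 at \<open>basis_vec n\<close>. Below,
    \<open>P\<close> is i (N^2 + 1)^-1 and \<open>Q\<close> is N (N^2 + 1)^-1.\<close>
  define r where "r n = complex_of_real (1 / (1 + (real n)\<^sup>2))" for n
  have le1: "cmod (\<i> * r n) \<le> 1" "cmod (of_nat n * r n) \<le> 1" for n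
  proof -
    have "real n \<le> 1 + (real n)\<^sup>2"
      using zero_le_power2[of "real n - 1"] by (simp add: power2_eq_square algebra_simps)
    moreover have "cmod (r n) = 1 / (1 + (real n)\<^sup>2)"
      unfolding r_def norm_of_real by simp
    ultimately show "cmod (\<i> * r n) \<le> 1" "cmod (of_nat n * r n) \<le> 1"
      by (simp_all add: norm_mult divide_le_eq_1 add_pos_nonneg)
  qed
  have r: "r n + of_nat n * of_nat n * r n = 1" for n
  proof -
    have "1 + (real n)\<^sup>2 > 0" by (simp add: add_pos_nonneg)
    then have "1 / (1 + (real n)\<^sup>2) + real n * real n * (1 / (1 + (real n)\<^sup>2)) = 1"
      by (simp add: add_divide_distrib[symmetric] power2_eq_square)
    from arg_cong[OF this, of complex_of_real] show ?thesis
      unfolding r_def by (simp only: of_real_add of_real_mult of_real_1 of_real_of_nat_eq)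
  qed
  have ii: "\<i> * \<i> = (- 1 :: complex)" by simp
  obtain P where P: "\<And>x n. coord (app P x) n = \<i> * r n * coord x (n + 0)"
    using weighted_shift_exists[where k = 0 and w = "\<lambda>n. \<i> * r n", OF le1(1)] by blast
  obtain Q where Q: "\<And>x n. coord (app Q x) n = of_nat n * r n * coord x (n + 0)"
    using weighted_shift_exists[where k = 0 and w = "\<lambda>n. of_nat n * r n", OF le1(2)] by blast
  define R where "R = dsum P P + dsum_off Q Q"
  have R: "app R x = (app P (fst x) + app Q (snd x), app Q (fst x) + app P (snd x))" for x
    by (simp add: R_def plus_bop.rep_eq dsum.rep_eq dsum_off.rep_eq add.commute)
  \<comment> \<open>Taken with the two components in either order, this gives both that
    \<open>app R x\<close> is in the domain and that it solves the resolvent equation.\<close>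
  have N: "coord (x + \<i> *\<^sub>C (app P x + app Q y)) n = of_nat n * coord (app Q x + app P y) n" for x y n
    unfolding ell2_coords P Q add_0_right using r[of n] ii by algebra
  have "app R x \<in> dirac_dom \<and> dirac_op (app R x) - \<i> *\<^sub>C app R x = x" for x
    using number_domI[OF N] number_op_eqI[OF N]
    by (cases x) (simp add: R dirac_dom_def dirac_op_def scaleC_prod_def add.commute)
  moreover have "app R (dirac_op x - \<i> *\<^sub>C x) = x" if "x \<in> dirac_dom" for x
  proof -
    have "app P (number_op y - \<i> *\<^sub>C x) + app Q (number_op x - \<i> *\<^sub>C y) = x"
      if "x \<in> number_dom" "y \<in> number_dom" for x y
    proof (rule ell2_eqI)
      fix n
      show "coord (app P (number_op y - \<i> *\<^sub>C x) + app Q (number_op x - \<i> *\<^sub>C y)) n = coord x n"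
        unfolding ell2_coords P Q add_0_right number_domD[OF that(1)] number_domD[OF that(2)]
        using r[of n] ii by algebra
    qed
    with that show ?thesis
      by (cases x) (simp add: R dirac_dom_def dirac_op_def scaleC_prod_def add.commute)
  qed
  ultimately show ?thesis unfolding is_resolvent_def by blast
qed

section \<open>Commutators of D with pairs of weighted shifts\<close>

lemma weighted_shift_number_dom:
  assumes S: "\<And>x n. coord (app S x) n = v n * coord x (n + k)"
    and v: "\<And>n. cmod (v n) \<le> K" and x: "x \<in> number_dom"
  shows "app S x \<in> number_dom"
proof -
  have K: "0 \<le> K" using v[of 0] norm_ge_zero order_trans by blast
  have "summable (\<lambda>n. (cmod (coord (number_op x) (n + k)))\<^sup>2)"
    by (rule summable_ignore_initial_segment[OF coord_square_summable])
  \<comment> \<open>Multiplying coordinate \<open>n + k\<close> of \<open>x\<close> by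
    \<open>n\<close> amounts to multiplying that of \<open>number_op x\<close> by n / (n + k), which
    is at most 1.\<close>
  then have "summable (\<lambda>n. (cmod (v n * (of_nat n / of_nat (n + k)) * coord (number_op x) (n + k)))\<^sup>2)"
  proof (rule square_summable_bounded_mult)
    fix n
    have "cmod (of_nat n / of_nat (n + k)) \<le> 1"
      unfolding norm_divide norm_of_nat by (auto simp: divide_le_eq_1 simp del: of_nat_add)
    then show "cmod (v n * (of_nat n / of_nat (n + k))) \<le> K"
      unfolding norm_mult using v[of n] K mult_mono[of "cmod (v n)" K _ 1] by fastforce
  qed
  moreover have "v n * (of_nat n / of_nat (n + k)) * coord (number_op x) (n + k) =
      of_nat n * coord (app S x) n" for n
  \<comment> \<open>For \<open>n + k = 0\<close> the quotient is 0 / 0 = 0, and both sides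
    vanish.\<close>
  proof (cases "n + k = 0")
    case False
    then have "(of_nat (n + k) :: complex) \<noteq> 0" by (simp only: of_nat_eq_0_iff not_False_eq_True)
    then show ?thesis by (simp add: S number_domD[OF x] field_simps del: of_nat_add)
  qed simp
  ultimately show ?thesis by (simp add: number_dom_def)
qed

text \<open>The commutator with \<open>D\<close> is off-diagonal with entries \<open>N T - S N\<close> and \<open>N S - T N\<close>, so the
  weights of \<open>S\<close> and \<open>T\<close> have to approach each other at rate \<open>1 / n\<close>.\<close>

lemma weighted_shift_bounded_commutator:
  assumes S: "\<And>x n. coord (app S x) n = v n * coord x (n + k)"
    and T: "\<And>x n. coord (app T x) n = w n * coord x (n + k)"
    and v: "\<And>n. cmod (v n) \<le> K" and w: "\<And>n. cmod (w n) \<le> K"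
    and vw: "\<And>n. real n * cmod (v n - w n) \<le> L"
  shows "dsum S T \<in> bounded_commutator_algebra dirac_dom dirac_op"
proof -
  have off: "\<exists>C. \<forall>x\<in>number_dom. app C x = number_op (app T' x) - app S' (number_op x)"
    if S': "\<And>x n. coord (app S' x) n = v' n * coord x (n + k)"
      and T': "\<And>x n. coord (app T' x) n = w' n * coord x (n + k)"
      and v': "\<And>n. cmod (v' n) \<le> K" and w': "\<And>n. cmod (w' n) \<le> K"
      and vw': "\<And>n. real n * cmod (v' n - w' n) \<le> L" for S' T' v' w'
  proof -
    \<comment> \<open>Coordinate \<open>n\<close> of N T' - S' N has weight n w' - (n + k) v', since
      N acts before the shift in the second term. The offset leaves the bounded term k v'.\<close>
    have "cmod (of_nat n * (w' n - v' n) - of_nat k * v' n) \<le> L + real k * K" for n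
    proof -
      have "cmod (of_nat n * (w' n - v' n) - of_nat k * v' n) \<le>
          real n * cmod (w' n - v' n) + real k * cmod (v' n)"
        by (rule order_trans[OF norm_triangle_ineq4]) (simp add: norm_mult)
      also have "\<dots> \<le> L + real k * K"
        using vw'[of n] v'[of n] by (intro add_mono mult_left_mono) (simp_all add: norm_minus_commute)
      finally show ?thesis .
    qed
    from weighted_shift_exists[where k = k and
        w = "\<lambda>n. of_nat n * (w' n - v' n) - of_nat k * v' n", OF this] obtain C where
      C: "\<And>x n. coord (app C x) n = (of_nat n * (w' n - v' n) - of_nat k * v' n) * coord x (n + k)"
      by blast
    have "app C x = number_op (app T' x) - app S' (number_op x)" if "x \<in> number_dom" for x
      by (rule ell2_eqI) (simp add: C S' T' ell2_coords number_domD[OF that]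
          number_domD[OF weighted_shift_number_dom[OF T' w' that]] algebra_simps)
    then show ?thesis by blast
  qed
  obtain C1 where C1: "\<And>x. x \<in> number_dom \<Longrightarrow> app C1 x = number_op (app T x) - app S (number_op x)"
    using off[OF S T v w vw] by blast
  obtain C2 where C2: "\<And>x. x \<in> number_dom \<Longrightarrow> app C2 x = number_op (app S x) - app T (number_op x)"
    using off[OF T S w v] vw by (metis norm_minus_commute)
  have "app (dsum_off C1 C2) x = dirac_op (app (dsum S T) x) - app (dsum S T) (dirac_op x)"
    if "x \<in> dirac_dom" for x
    using that by (auto simp: dirac_dom_def dirac_op_def dsum.rep_eq dsum_off.rep_eq C1 C2)
  moreover have "app (dsum S T) x \<in> dirac_dom" if "x \<in> dirac_dom" for x
    using that weighted_shift_number_dom[OF S v] weighted_shift_number_dom[OF T w]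
    by (auto simp: dirac_dom_def dsum.rep_eq)
  ultimately show ?thesis
    unfolding bounded_commutator_algebra_def by blast
qed

section \<open>Weights of the two representations, and the commutators with A and B\<close>

context
  fixes s q c :: real
  assumes s: "s = 1 \<or> s = - 1" and q: "\<bar>q\<bar> < 1" and c: "c > 0"
begin

text \<open>Coordinates are read off through the adjoint, whose values on basis vectors are known.
  The index \<open>n + 0\<close> presents the operator as a weighted shift with
  \<open>k = 0\<close>.\<close>

lemma coord_podles_rep_A:
  "coord (app (podles_rep_A s q c) x) n = of_real (podles_lambda s c * q ^ (2 * n)) * coord x (n + 0)"
proof -
  have "star (podles_rep_A s q c) = podles_rep_A s q c"
    using podles_rep_relations[OF s q c] by (simp add: podles_relations_def)
  then show ?thesis
    by (simp add: coord_app podles_rep_A_basis[OF s q c] cinner_scaleC_left cinner_basis_left)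
qed

lemma coord_podles_rep_B:
  "coord (app (podles_rep_B s q c) x) n = of_real (sqrt (podles_coeff s q c (n + 1))) * coord x (n + 1)"
  by (simp add: coord_app star_podles_rep_B_basis[OF s q c] cinner_scaleC_left cinner_basis_left)

text \<open>Multiplying by the sum of the two roots, which is at least \<open>sqrt c\<close>, turns
  the left side into |l t - (l t)^2| with t = \<open>q ^ (2 * n)\<close>; as t lies in [0, 1], t^2
  is at most t.\<close>

lemma sqrt_podles_coeff_diff:
  "\<bar>sqrt (podles_coeff s q c n) - sqrt c\<bar> \<le>
     (\<bar>podles_lambda s c\<bar> + (podles_lambda s c)\<^sup>2) / sqrt c * q ^ (2 * n)"
proof -
  let ?l = "podles_lambda s c" and ?a = "podles_coeff s q c n" and ?t = "q ^ (2 * n)"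
  have t: "0 \<le> ?t" "?t \<le> 1" using q_power_even[OF s q c] by auto
  have a: "0 \<le> ?a" by (rule podles_coeff_nonneg[OF s q c])
  have "?t * ?t \<le> ?t" using t by (simp add: mult_left_le)
  then have t2: "?t\<^sup>2 \<le> ?t" by (simp add: power2_eq_square)
  have "(sqrt ?a - sqrt c) * (sqrt ?a + sqrt c) = ?l * ?t - (?l * ?t)\<^sup>2"
  proof -
    have "(sqrt ?a - sqrt c) * (sqrt ?a + sqrt c) = sqrt ?a * sqrt ?a - sqrt c * sqrt c"
      by (simp only: square_diff_square_factored mult.commute)
    also have "\<dots> = ?a - c" using a c by simp
    finally show ?thesis by (simp add: podles_coeff_def)
  qed
  then have "\<bar>sqrt ?a - sqrt c\<bar> * (sqrt ?a + sqrt c) = \<bar>?l * ?t - (?l * ?t)\<^sup>2\<bar>"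
    using a c by (metis abs_mult abs_of_nonneg add_nonneg_nonneg less_imp_le real_sqrt_ge_zero)
  also have "\<dots> \<le> \<bar>?l\<bar> * ?t + ?l\<^sup>2 * ?t\<^sup>2"
    using abs_triangle_ineq4[of "?l * ?t" "(?l * ?t)\<^sup>2"] t by (simp add: abs_mult power_mult_distrib)
  also have "\<dots> \<le> (\<bar>?l\<bar> + ?l\<^sup>2) * ?t"
    using mult_left_mono[OF t2, of "?l\<^sup>2"] by (simp add: algebra_simps)
  finally have "\<bar>sqrt ?a - sqrt c\<bar> * (sqrt ?a + sqrt c) \<le> (\<bar>?l\<bar> + ?l\<^sup>2) * ?t" .
  moreover have "\<bar>sqrt ?a - sqrt c\<bar> * sqrt c \<le> \<bar>sqrt ?a - sqrt c\<bar> * (sqrt ?a + sqrt c)"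
    using a by (intro mult_left_mono) auto
  ultimately show ?thesis using c by (simp add: field_simps)
qed

end

lemma q_power_even_decay:
  fixes q :: real
  assumes "\<bar>q\<bar> < 1"
  obtains K where "\<And>n. real n * q ^ (2 * n) \<le> K"
proof -
  have "norm (q\<^sup>2) < 1" using assms by (simp add: abs_square_less_1)
  then have "(\<lambda>n. real n * (q\<^sup>2) ^ n) \<longlonglongrightarrow> 0" by (rule powser_times_n_limit_0)
  then have "Bseq (\<lambda>n. real n * (q\<^sup>2) ^ n)"
    by (intro convergent_imp_Bseq convergentI)
  then obtain K where "\<And>n. \<bar>real n * (q\<^sup>2) ^ n\<bar> \<le> K"
    unfolding Bseq_def real_norm_def by blast
  then have "real n * (q\<^sup>2) ^ n \<le> K" for n by (rule abs_le_D1)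
  then show ?thesis by (intro that) (simp only: power_mult)
qed

lemma podles_rep_A_bounded_commutator:
  assumes q: "\<bar>q\<bar> < 1" and c: "c > 0"
  shows "dsum (podles_rep_A 1 q c) (podles_rep_A (- 1) q c)
    \<in> bounded_commutator_algebra dirac_dom dirac_op"
proof -
  \<comment> \<open>These discharge the sign hypothesis and thereby fix \<open>s = 1\<close> and
    \<open>s = - 1\<close>.\<close>
  note st = disjI1[OF refl] disjI2[OF refl]
  let ?l = "podles_lambda 1 c" and ?m = "podles_lambda (- 1) c"
  obtain L where L: "\<And>n. real n * q ^ (2 * n) \<le> L" using q_power_even_decay[OF q] by blast
  have t: "0 \<le> q ^ (2 * n)" "q ^ (2 * n) \<le> 1" for n using q_power_even[OF st(1) q c] by auto
  \<comment> \<open>One bound has to serve both weight sequences, hence the sum of the two absolute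
    values.\<close>
  have bd: "cmod (of_real (l * q ^ (2 * n))) \<le> \<bar>?l\<bar> + \<bar>?m\<bar>" if "\<bar>l\<bar> \<le> \<bar>?l\<bar> + \<bar>?m\<bar>" for l n
    unfolding norm_of_real abs_mult using mult_mono[OF that t(2)[of n]] t(1)[of n] by simp
  have diff: "real n * cmod (of_real (?l * q ^ (2 * n)) - of_real (?m * q ^ (2 * n))) \<le> \<bar>?l - ?m\<bar> * L" for n
  proof -
    have "cmod (of_real (?l * q ^ (2 * n)) - of_real (?m * q ^ (2 * n))) = \<bar>?l - ?m\<bar> * q ^ (2 * n)"
      unfolding of_real_diff[symmetric] norm_of_real left_diff_distrib[symmetric] abs_mult
      using t(1) by simp
    then show ?thesis using mult_left_mono[OF L[of n], of "\<bar>?l - ?m\<bar>"] by (simp add: mult_ac)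
  qed
  show ?thesis
    by (rule weighted_shift_bounded_commutator[OF coord_podles_rep_A[OF st(1) q c]
          coord_podles_rep_A[OF st(2) q c] bd bd diff]) simp_all
qed

lemma podles_rep_B_bounded_commutator:
  assumes q: "\<bar>q\<bar> < 1" and c: "c > 0"
  shows "dsum (podles_rep_B 1 q c) (podles_rep_B (- 1) q c)
    \<in> bounded_commutator_algebra dirac_dom dirac_op"
proof -
  note st = disjI1[OF refl] disjI2[OF refl]
  define G where "G s = (\<bar>podles_lambda s c\<bar> + (podles_lambda s c)\<^sup>2) / sqrt c" for s
  have G: "0 \<le> G s" for s using c by (simp add: G_def)
  let ?f = "\<lambda>s n. sqrt (podles_coeff s q c (n + 1))"
  obtain L where L: "\<And>n. real n * q ^ (2 * n) \<le> L" using q_power_even_decay[OF q] by blast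
  have t: "0 \<le> q ^ (2 * n)" for n using q_power_even[OF st(1) q c] by auto
  have bd: "cmod (of_real (?f s n)) \<le> sqrt (c + 1/4)" if "s = 1 \<or> s = - 1" for s n
    using podles_coeff_nonneg[OF that q c] podles_coeff_le[OF that q c] by simp
  have diff: "real n * cmod (of_real (?f 1 n) - of_real (?f (- 1) n)) \<le> (G 1 + G (- 1)) * L" for n
  proof -
    have "cmod (of_real (?f 1 n) - of_real (?f (- 1) n)) = \<bar>?f 1 n - ?f (- 1) n\<bar>"
      by (metis norm_of_real of_real_diff)
    also have "\<dots> \<le> \<bar>?f 1 n - sqrt c\<bar> + \<bar>?f (- 1) n - sqrt c\<bar>" by linarith
    also have "\<dots> \<le> G 1 * q ^ (2 * (n + 1)) + G (- 1) * q ^ (2 * (n + 1))"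
      unfolding G_def by (intro add_mono sqrt_podles_coeff_diff q c) simp_all
    \<comment> \<open>The weight of B at position \<open>n\<close> is taken at \<open>n + 1\<close>,
      so the factor \<open>n\<close> is enlarged to \<open>n + 1\<close> to match the decay bound
      \<open>L\<close>.\<close>
    finally have "real n * cmod (of_real (?f 1 n) - of_real (?f (- 1) n)) \<le>
        real (n + 1) * ((G 1 + G (- 1)) * q ^ (2 * (n + 1)))"
      by (intro mult_mono) (simp_all add: distrib_right)
    also have "\<dots> = (G 1 + G (- 1)) * (real (n + 1) * q ^ (2 * (n + 1)))" by (simp only: mult_ac)
    also have "\<dots> \<le> (G 1 + G (- 1)) * L"
      using G by (intro mult_left_mono L) simp
    finally show ?thesis .
  qed
  show ?thesis
    by (rule weighted_shift_bounded_commutator[OF coord_podles_rep_B[OF st(1) q c]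
          coord_podles_rep_B[OF st(2) q c] bd bd diff]) simp_all
qed

section \<open>The direct sum representation and the spectral triple\<close>

lemma dsum_algebra:
  "dsum S T + dsum S' T' = dsum (S + S') (T + T')" "dsum S T * dsum S' T' = dsum (S * S') (T * T')"
  "a *\<^sub>C dsum S T = dsum (a *\<^sub>C S) (a *\<^sub>C T)" "star (dsum S T) = dsum (star S) (star T)"
  by (intro bop_eqI star_bopI; simp add: dsum.rep_eq plus_bop.rep_eq times_bop.rep_eq
      scaleC_bop.rep_eq scaleC_prod_def cinner_prod_def cinner_star)+

text \<open>The operations on \<open>podles_elem\<close> are pointwise, so evaluation is a
  homomorphism on all functions, and preimages under it are subalgebras of the whole
  product.\<close>

lemma podles_pi_star_hom: "star_hom_on UNIV (podles_pi q c)"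
  by (simp add: star_hom_on_def podles_pi_def podles_rep_def dsum_algebra star_fun_def scaleC_fun_def)

text \<open>Only subalgebras inside \<open>podles_sphere\<close> enter the intersection that defines
  \<open>podles_fin\<close>, and \<open>S\<close> may be larger. Its intersection with
  \<open>?G\<close> qualifies, since elements of \<open>?G\<close> approximate themselves with error
  0.\<close>

lemma podles_fin_subset:
  assumes "star_subalgebra S" "podles_A q c \<in> S" "podles_B q c \<in> S"
  shows "podles_fin q c \<subseteq> S"
proof -
  let ?G = "star_generated {podles_I q c, podles_A q c, podles_B q c}"
  have "?G \<subseteq> podles_sphere q c"
    unfolding podles_sphere_def by (auto intro!: bexI simp: zero_bop.rep_eq onorm_zero)
  moreover have "star_subalgebra (S \<inter> ?G)"
    by (intro star_subalgebra_Int assms star_subalgebra_generated)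
  moreover have "{podles_A q c, podles_B q c} \<subseteq> S \<inter> ?G"
    using assms star_generated_superset[of "{podles_I q c, podles_A q c, podles_B q c}"] by blast
  ultimately show ?thesis
    unfolding podles_fin_def by blast
qed

text \<open>The generators are set to 0 at pairs violating the relations, so their values here rest
  on \<open>podles_rep_relations\<close>.\<close>

lemma podles_pi_generators:
  assumes "\<bar>q\<bar> < 1" "c > 0"
  shows "podles_pi q c (podles_A q c) = dsum (podles_rep_A 1 q c) (podles_rep_A (- 1) q c)"
    "podles_pi q c (podles_B q c) = dsum (podles_rep_B 1 q c) (podles_rep_B (- 1) q c)"
  using assms
  by (simp_all add: podles_pi_def podles_rep_def podles_evaluation[OF podles_rep_relations])

theorem proposition5p3:
  fixes q c :: real
  assumes "\<bar>q\<bar> < 1" and "c > 0"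
  shows "even_spectral_triple (podles_fin q c) (podles_pi q c)
           dirac_dom dirac_op (dsum 1 (- 1))"
  unfolding even_spectral_triple_def
proof (intro conjI ballI)
  show "star_subalgebra (podles_fin q c)"
    unfolding podles_fin_def by (rule star_subalgebra_Inter) blast
  show "star_hom_on (podles_fin q c) (podles_pi q c)"
    by (rule star_hom_on_subset[OF podles_pi_star_hom]) simp
  show "self_adjoint dirac_dom dirac_op" by (rule dirac_self_adjoint)
  show "compact_resolvent dirac_dom dirac_op"
    unfolding compact_resolvent_def using dirac_resolvent_exists dirac_resolvent_compact by blast
  show "bounded_commutator dirac_dom dirac_op (podles_pi q c b)" if "b \<in> podles_fin q c" for b
  proof (rule bounded_commutatorI)
    show "closure dirac_dom = UNIV" using dirac_self_adjoint by (simp add: self_adjoint_def)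
    have "podles_fin q c \<subseteq> podles_pi q c -` bounded_commutator_algebra dirac_dom dirac_op"
      by (intro podles_fin_subset star_subalgebra_vimage podles_pi_star_hom
          star_subalgebra_bounded_commutator dirac_self_adjoint)
        (simp_all add: assms podles_pi_generators podles_rep_A_bounded_commutator
          podles_rep_B_bounded_commutator)
    with that show "podles_pi q c b \<in> bounded_commutator_algebra dirac_dom dirac_op" by blast
  qed
  have "cinner (- x) y = cinner x (- y)" for x y :: ell2
    using cinner_scaleC_left[of "- 1" x y] cinner_scaleC_right[of x "- 1" y]
    by (simp add: scaleC_minus_left scaleC_one)
  then have "star (1 :: ell2 bop) = 1" "star (- 1 :: ell2 bop) = - 1"
    by (intro star_bopI; simp add: one_bop.rep_eq uminus_bop.rep_eq)+
  then show "star (dsum 1 (- 1) :: (ell2 \<times> ell2) bop) = dsum 1 (- 1)"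
    by (simp add: dsum_algebra)
  have "dsum 1 1 = (1 :: (ell2 \<times> ell2) bop)"
    by (rule bop_eqI) (simp add: dsum.rep_eq one_bop.rep_eq)
  then show "dsum 1 (- 1) * dsum 1 (- 1) = (1 :: (ell2 \<times> ell2) bop)"
    by (simp add: dsum_algebra)
  show "dsum 1 (- 1) * podles_pi q c b = podles_pi q c b * dsum 1 (- 1)" for b
    by (simp add: podles_pi_def dsum_algebra)
  fix x assume x: "x \<in> dirac_dom"
  have neg: "- y \<in> number_dom" "number_op (- y) = - number_op y" if "y \<in> number_dom" for y
    using number_dom_linear(4)[OF that, of "- 1"] by (simp_all add: scaleC_minus_left scaleC_one)
  show "app (dsum 1 (- 1)) x \<in> dirac_dom"
    "dirac_op (app (dsum 1 (- 1)) x) = - app (dsum 1 (- 1)) (dirac_op x)"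
    using x by (auto simp: dsum.rep_eq dirac_dom_def dirac_op_def one_bop.rep_eq uminus_bop.rep_eq neg)
qed

end
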